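(* Let $T\in B(H)$ be an operator which is not of the form $T=\lambda+K$ for some $\lambda\in\mathbb C$ and a compact operator $K\in B(H)$. Then there exist an orthonormal basis $(u_n)_{n=1}^\infty\subset H$ and strictly positive constants $c_1,c_2$ and $d$ depending only on the diameter of $W_e(T)$ such that $$|\langle Tu_n,u_n\rangle|\ge d,\qquad n\in\mathbb N,$$ and $$\frac{c_1\min\{n,j\}^{1/2}}{\max\{n,j\}^{3/2}}\le|\langle Tu_n,u_j\rangle|\le\frac{c_2}{\max\{n,j\}^{1/2}}$$ for all $n,j\in\mathbb N$, $n\ne j$.
   Context: $H$ is a separable infinite-dimensional complex Hilbert space and $B(H)$ is the space of bounded linear operators on $H$; a scalar $\lambda$ is identified with $\lambda I$. $\mathbb N=\{1,2,\dots\}$. The essential numerical range $W_e(T)\subset\mathbb C$ of $T\in B(H)$ is the set of all $\lambda\in\mathbb C$ for which there exists an orthonormal sequence $(e_n)_{n=1}^\infty\subset H$ with $\langle Te_n,e_n\rangle\to\lambda$ as $n\to\infty$ (it is a nonempty, compact, convex set). Its diameter is $\max\{|\lambda-\mu|:\lambda,\mu\in W_e(T)\}$. *)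

theory Defs
  imports "HOL-Analysis.Analysis"
begin

text \<open>
  Complex inner product spaces, with the inner product linear in the first argument.
  The underlying real inner product space (hence norm and topology) is the library's: the last two
  axioms tie it to the complex structure.  Positive definiteness follows, since
  \<open>cinner x x\<close> is real by \<open>cinner_commute\<close> and its real part is \<open>inner x x\<close>.
\<close>

class complex_inner = real_inner +
  fixes scaleC :: "complex \<Rightarrow> 'a \<Rightarrow> 'a" (infixr "*\<^sub>C" 75)
    and cinner :: "'a \<Rightarrow> 'a \<Rightarrow> complex"
  assumes scaleC_add_right: "a *\<^sub>C (x + y) = a *\<^sub>C x + a *\<^sub>C y"
    and scaleC_add_left: "(a + b) *\<^sub>C x = a *\<^sub>C x + b *\<^sub>C x"
    and scaleC_scaleC: "a *\<^sub>C b *\<^sub>C x = (a * b) *\<^sub>C x"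
    and scaleC_one: "1 *\<^sub>C x = x"
    and cinner_commute: "cinner x y = cnj (cinner y x)"
    and cinner_add_left: "cinner (x + y) z = cinner x z + cinner y z"
    and cinner_scaleC_left: "cinner (a *\<^sub>C x) y = a * cinner x y"
    and scaleC_of_real: "complex_of_real r *\<^sub>C x = r *\<^sub>R x"
    and inner_eq_Re_cinner: "inner x y = Re (cinner x y)"

class complex_hilbert = complex_inner + complete_space

global_interpretation complex_vector:
  vector_space "scaleC :: complex \<Rightarrow> 'a \<Rightarrow> 'a::complex_inner"
  defines cspan = complex_vector.span
  by standard (rule scaleC_add_right scaleC_add_left scaleC_scaleC scaleC_one)+

definition infinite_dimensional :: "'a::complex_inner itself \<Rightarrow> bool" where
  "infinite_dimensional _ \<longleftrightarrow> (\<nexists>B::'a set. finite B \<and> cspan B = UNIV)"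

definition bounded_clinear :: "('a::complex_inner \<Rightarrow> 'a) \<Rightarrow> bool" where
  "bounded_clinear T \<longleftrightarrow> bounded_linear T \<and> (\<forall>a x. T (a *\<^sub>C x) = a *\<^sub>C T x)"

definition compact_operator :: "('a::complex_inner \<Rightarrow> 'a) \<Rightarrow> bool" where
  "compact_operator K \<longleftrightarrow> bounded_clinear K \<and> compact (closure (K ` cball 0 1))"

text \<open>Sequences are indexed by \<open>{1,2,\<dots>}\<close>; the value at \<open>0\<close> is ignored.\<close>

definition orthonormal_seq :: "(nat \<Rightarrow> 'a::complex_inner) \<Rightarrow> bool" where
  "orthonormal_seq e \<longleftrightarrow> (\<forall>m\<ge>1. \<forall>n\<ge>1. cinner (e m) (e n) = (if m = n then 1 else 0))"

definition orthonormal_basis :: "(nat \<Rightarrow> 'a::complex_inner) \<Rightarrow> bool" where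
  "orthonormal_basis u \<longleftrightarrow> orthonormal_seq u \<and> closure (cspan (u ` {1..})) = UNIV"

definition ess_num_range :: "('a::complex_inner \<Rightarrow> 'a) \<Rightarrow> complex set" where
  "ess_num_range T =
    {z. \<exists>e. orthonormal_seq e \<and> (\<lambda>n. cinner (T (e n)) (e n)) \<longlonglongrightarrow> z}"

end

theory Submission
  imports Defs
begin

text \<open>
  Let \<open>\<delta>\<close> be the diameter of \<open>W = ess_num_range T\<close>. It is positive: if \<open>W\<close> had at most one
  point \<open>z\<close>, the quadratic form of \<open>T - z\<close> would be small off a finite-dimensional space, hence by
  polarization \<open>T - z\<close> itself would be, and it would be compact
  (\<open>compact_operator_if_ess_num_range_singleton\<close>). Put \<open>S = T - \<alpha>\<close> for a point \<open>\<alpha>\<close> of \<open>W\<close>. This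
  changes no off-diagonal entry, and for the same reason \<open>S\<close> is bounded by \<open>4 * \<delta>\<close> off a
  finite-dimensional space spanned by a set \<open>F\<close>. That is why the constants depend on \<open>\<delta>\<close> alone:
  only tiny components, of a size that may depend on \<open>norm S\<close>, ever leave the complement of \<open>F\<close>.

  The basis is built one vector at a time, as \<open>u n = s v + x\<close>. Here \<open>x\<close> lies in the span of the
  vectors used so far and is orthogonal to the earlier \<open>u j\<close>, while \<open>v\<close> is a fresh unit vector:
  \<open>v\<close>, \<open>S v\<close> and the adjoint image of \<open>v\<close> are orthogonal to everything used so far. So \<open>v\<close> nearly fixes
  the diagonal entry, and the entries of \<open>S\<close> between \<open>u n\<close> and an earlier \<open>u j\<close> come from \<open>x\<close>
  alone. The upper bound asks for \<open>norm x\<close> of order \<open>1 / sqrt n\<close>. The vector \<open>x = y + h \<rho>\<close> has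
  two tasks.

  The part \<open>y\<close> produces the lower bounds. Together with \<open>v\<close> a second fresh vector is chosen that
  \<open>S\<close> couples to \<open>v\<close> with strength of order \<open>\<delta>\<close>, in both directions; it starts a reservoir
  vector \<open>p n\<close>. The entry between \<open>y = (\<Sum>j<n. c j *\<^sub>R p j)\<close> and \<open>u j\<close> contains \<open>c j\<close> times a
  number of size at least \<open>\<delta> / 5\<close>, and by freshness it involves only \<open>c 1, \<dots>, c j\<close>. Hence the
  \<open>c j\<close> can be picked one after the other, each avoiding a few small discs, so that all entries
  have size at least \<open>c1 * sqrt j / n powr (3/2)\<close> with \<open>c j\<close> of the same order
  (\<open>avoid_discs_triangular\<close>). This order is admissible because the sum of \<open>j / n ^ 3\<close> over
  \<open>j < n\<close> is about \<open>1 / n\<close>. The reservoir vectors must then be made orthogonal to the new \<open>u n\<close>;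
  this is done by adding multiples of \<open>v\<close>, which disturbs none of their couplings to earlier
  basis vectors, and costs only a growth of squared norms by \<open>1 + 1 / n\<close> per step
  (\<open>extend_admissible\<close>). Since small \<open>j\<close> carry little weight in \<open>j / n ^ 3\<close>, such polynomial
  growth is harmless (\<open>reservoir_weights\<close>).

  The part \<open>h \<rho>\<close> produces completeness: \<open>\<rho>\<close> is the normalized residual of a member of a dense
  sequence, and \<open>h\<close> is a small multiple of \<open>1 / sqrt n\<close>. Each such step multiplies the squared
  residual by at most \<open>1 - h\<^sup>2\<close>, and as the harmonic series diverges, already along the numbers
  with a given multiplicity of \<open>2\<close>, every residual tends to \<open>0\<close> (\<open>drained_in_closure\<close>).
\<close>

section \<open>Complex inner products\<close>

lemma scaleR_eq_scaleC: "r *\<^sub>R x = complex_of_real r *\<^sub>C (x :: 'a::complex_inner)"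
  by (simp add: scaleC_of_real)

lemma scaleC_scaleR: "a *\<^sub>C (r *\<^sub>R x) = r *\<^sub>R (a *\<^sub>C (x :: 'a::complex_inner))"
  by (simp add: scaleR_eq_scaleC scaleC_scaleC mult.commute)

lemma cinner_scaleR_left: "cinner (r *\<^sub>R x) y = complex_of_real r * cinner (x :: 'a::complex_inner) y"
  by (simp add: scaleR_eq_scaleC cinner_scaleC_left)

lemma cinner_zero_left [simp]: "cinner (0 :: 'a::complex_inner) y = 0"
  using cinner_scaleR_left[of 0 0 y] by simp

lemma cinner_minus_left: "cinner (- x) y = - cinner (x :: 'a::complex_inner) y"
  using cinner_scaleR_left[of "-1" x y] by simp

lemma cinner_diff_left: "cinner (x - y) z = cinner x z - cinner (y :: 'a::complex_inner) z"
  using cinner_add_left[of x "- y" z] by (simp add: cinner_minus_left)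

lemma cinner_sum_left: "cinner (sum f A) y = (\<Sum>i\<in>A. cinner (f i :: 'a::complex_inner) y)"
  by (induction A rule: infinite_finite_induct) (auto simp: cinner_add_left)

lemma cinner_add_right: "cinner z (x + y) = cinner z x + cinner z (y :: 'a::complex_inner)"
  by (metis cinner_add_left cinner_commute complex_cnj_add)

lemma cinner_scaleC_right: "cinner x (a *\<^sub>C y) = cnj a * cinner x (y :: 'a::complex_inner)"
  by (metis cinner_commute cinner_scaleC_left complex_cnj_mult)

lemma cinner_scaleR_right: "cinner x (r *\<^sub>R y) = complex_of_real r * cinner (x :: 'a::complex_inner) y"
  by (simp add: scaleR_eq_scaleC cinner_scaleC_right)

lemma cinner_zero_right [simp]: "cinner x (0 :: 'a::complex_inner) = 0"
  using cinner_scaleR_right[of x 0 0] by simp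

lemma cinner_minus_right: "cinner x (- y) = - cinner (x :: 'a::complex_inner) y"
  using cinner_scaleR_right[of x "-1" y] by simp

lemma cinner_diff_right: "cinner z (x - y) = cinner z x - cinner z (y :: 'a::complex_inner)"
  using cinner_add_right[of z x "- y"] by (simp add: cinner_minus_right)

lemma cinner_sum_right: "cinner y (sum f A) = (\<Sum>i\<in>A. cinner y (f i :: 'a::complex_inner))"
  by (induction A rule: infinite_finite_induct) (auto simp: cinner_add_right)

lemmas cinner_simps = cinner_add_left cinner_add_right cinner_diff_left cinner_diff_right
  cinner_scaleR_left cinner_scaleR_right cinner_scaleC_left cinner_scaleC_right

lemma cinner_eq_zero_commute: "cinner x y = 0 \<longleftrightarrow> cinner y (x :: 'a::complex_inner) = 0"
  by (metis cinner_commute complex_cnj_zero_iff)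

lemma cinner_self: "cinner x x = complex_of_real ((norm (x :: 'a::complex_inner))\<^sup>2)"
proof (rule complex_eqI)
  show "Re (cinner x x) = Re (complex_of_real ((norm x)\<^sup>2))"
    by (simp add: power2_norm_eq_inner inner_eq_Re_cinner)
  have "Im (cinner x x) = - Im (cinner x x)"
    by (subst (1) cinner_commute) simp
  then show "Im (cinner x x) = Im (complex_of_real ((norm x)\<^sup>2))" by simp
qed

lemma norm_sq_cinner: "(norm (x :: 'a::complex_inner))\<^sup>2 = Re (cinner x x)"
  by (simp add: cinner_self)

lemma norm_eq_1_cinner: "norm (x :: 'a::complex_inner) = 1 \<longleftrightarrow> cinner x x = 1"
  using abs_square_eq_1[of "norm x"] by (simp add: cinner_self flip: of_real_power)

lemma norm_scaleC: "norm (a *\<^sub>C (x :: 'a::complex_inner)) = cmod a * norm x"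
proof -
  have "(norm (a *\<^sub>C x))\<^sup>2 = Re ((a * cnj a) * cinner x x)"
    unfolding norm_sq_cinner cinner_simps by (simp only: mult_ac)
  also have "\<dots> = (cmod a * norm x)\<^sup>2"
    by (simp add: complex_norm_square[symmetric] cinner_self power_mult_distrib
        flip: of_real_power of_real_mult)
  finally show ?thesis
    by (simp add: power2_eq_iff_nonneg)
qed

lemma cinner_Cauchy_Schwarz: "cmod (cinner x y) \<le> norm x * norm (y :: 'a::complex_inner)"
proof (cases "cinner x y = 0")
  case False
  define c where "c = cinner x y"
  define w where "w = cnj c / cmod c"
  have c: "c \<noteq> 0" using False by (simp add: c_def)
  have w: "cmod w = 1" using c by (simp add: w_def norm_divide)
  have "w * c = cmod c"
    using c by (simp add: w_def mult.commute[of "cnj c"] complex_norm_square[symmetric] power2_eq_square)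
  then have "cmod c = Re (cinner (w *\<^sub>C x) y)" by (simp add: cinner_simps c_def)
  also have "\<dots> = inner (w *\<^sub>C x) y" by (simp add: inner_eq_Re_cinner)
  also have "\<dots> \<le> norm (w *\<^sub>C x) * norm y" by (rule norm_cauchy_schwarz)
  finally show ?thesis by (simp add: norm_scaleC w c_def)
qed simp

lemma pythagoras:
  assumes "cinner x y = 0"
  shows "(norm (x + y :: 'a::complex_inner))\<^sup>2 = (norm x)\<^sup>2 + (norm y)\<^sup>2"
  using assms cinner_eq_zero_commute[of x y] by (simp add: norm_sq_cinner cinner_simps)

lemma bounded_linear_cinner_left: "bounded_linear (\<lambda>x :: 'a::complex_inner. cinner x y)"
proof (rule bounded_linear_intro[where K = "norm y"])
  show "norm (cinner x y) \<le> norm x * norm y" for x :: 'a by (rule cinner_Cauchy_Schwarz)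
qed (auto simp: cinner_simps scaleR_conv_of_real)

section \<open>Bounded complex-linear maps\<close>

lemma bounded_clinear_add: "bounded_clinear T \<Longrightarrow> T (x + y) = T x + T y"
  unfolding bounded_clinear_def by (simp add: linear_simps)

lemma bounded_clinear_diff: "bounded_clinear T \<Longrightarrow> T (x - y) = T x - T y"
  unfolding bounded_clinear_def by (simp add: linear_simps)

lemma bounded_clinear_scaleR: "bounded_clinear T \<Longrightarrow> T (r *\<^sub>R x) = r *\<^sub>R T x"
  unfolding bounded_clinear_def by (simp add: linear_simps)

lemma bounded_clinear_scaleC: "bounded_clinear T \<Longrightarrow> T (a *\<^sub>C x) = a *\<^sub>C T x"
  unfolding bounded_clinear_def by simp

lemma bounded_clinear_sum: "bounded_clinear T \<Longrightarrow> T (sum f A) = (\<Sum>i\<in>A. T (f i))"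
  unfolding bounded_clinear_def by (simp add: linear_sum bounded_linear.linear)

lemmas bounded_clinear_simps = bounded_clinear_add bounded_clinear_diff bounded_clinear_scaleR
  bounded_clinear_scaleC

lemma bounded_clinear_bound:
  assumes "bounded_clinear T"
  obtains K where "K > 0" "\<And>x. norm (T x) \<le> K * norm x"
  using assms bounded_linear.pos_bounded unfolding bounded_clinear_def by (metis mult.commute)

lemma bounded_clinear_shift:
  assumes "bounded_clinear T"
  shows "bounded_clinear (\<lambda>x. T x - z *\<^sub>C x)"
proof -
  have "bounded_linear (\<lambda>x :: 'a. z *\<^sub>C x)"
    by (rule bounded_linear_intro[where K = "cmod z"])
      (auto simp: scaleC_add_right scaleC_scaleR norm_scaleC)
  then show ?thesis
    using assms unfolding bounded_clinear_def
    by (auto intro: bounded_linear_sub simp: complex_vector.scale_right_diff_distrib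
        scaleC_scaleC mult.commute)
qed

section \<open>Riesz representation and adjoints\<close>

text \<open>
  The representing vector minimizes \<open>(norm x)\<^sup>2 - 2 * f x\<close>; the parallelogram law makes every
  minimizing sequence Cauchy.
\<close>

lemma Riesz_representation:
  fixes f :: "'a::{real_inner,complete_space} \<Rightarrow> real"
  assumes f: "bounded_linear f"
  obtains z where "\<And>x. f x = inner x z"
proof -
  interpret bounded_linear f by (rule f)
  obtain B where B: "\<And>x. norm (f x) \<le> norm x * B" using bounded by blast
  define J where "J x = (norm x)\<^sup>2 - 2 * f x" for x
  have J_ge: "J x \<ge> - B\<^sup>2" for x
  proof -
    have "0 \<le> (norm x - B)\<^sup>2" by simp
    moreover have "f x \<le> norm x * B" using B[of x] by simp
    ultimately show ?thesis by (simp add: J_def power2_diff)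
  qed
  have bdd: "bdd_below (range J)" using J_ge by (auto intro!: bdd_belowI)
  define m where "m = Inf (range J)"
  have m_le: "m \<le> J x" for x unfolding m_def by (rule cINF_lower[OF bdd]) simp
  have "\<exists>x. J x < m + 1 / real (Suc n)" for n
    using cInf_lessD[of "range J" "m + 1 / real (Suc n)"] by (auto simp: m_def)
  then obtain x where x: "\<And>n. J (x n) < m + 1 / real (Suc n)" by metis
  have mid: "J a + J b - 2 * J ((1/2) *\<^sub>R (a + b)) = (norm (a - b))\<^sup>2 / 2" for a b
    unfolding J_def scaleR add power2_norm_eq_inner
    by (simp add: inner_add_left inner_add_right inner_diff_left inner_diff_right
        inner_commute field_simps)
  \<comment> \<open>\<open>m\<close> is a lower bound of \<open>J\<close> at the midpoint, so near-minimizers are close to each other\<close>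
  have close: "(dist (x i) (x j))\<^sup>2 < 2 * (1 / real (Suc i) + 1 / real (Suc j))" for i j
  proof -
    have "d < 2 * (p + q)" if "a + b - 2 * c = d / 2" "a < m + p" "b < m + q" "m \<le> c"
      for a b c d p q :: real
      using that by argo
    from this[OF mid x x m_le] show ?thesis by (simp add: dist_norm)
  qed
  have "Cauchy x"
  proof (rule metric_CauchyI)
    fix e :: real assume e: "e > 0"
    obtain N where N: "1 / real (Suc N) < e\<^sup>2 / 4"
      using reals_Archimedean[of "e\<^sup>2 / 4"] e by (auto simp: inverse_eq_divide)
    have "dist (x i) (x j) < e" if "i \<ge> N" "j \<ge> N" for i j
    proof -
      have "1 / real (Suc i) \<le> 1 / real (Suc N)" "1 / real (Suc j) \<le> 1 / real (Suc N)"
        using that by (auto simp: field_simps)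
      with N close[of i j] have "(dist (x i) (x j))\<^sup>2 < e\<^sup>2" by argo
      then show ?thesis using e by (simp add: power2_less_imp_less)
    qed
    then show "\<exists>N. \<forall>i\<ge>N. \<forall>j\<ge>N. dist (x i) (x j) < e" by blast
  qed
  then obtain z where z: "x \<longlonglongrightarrow> z" using Cauchy_convergent_iff convergent_def by blast
  have "(\<lambda>n. J (x n)) \<longlonglongrightarrow> J z"
    unfolding J_def by (intro tendsto_intros z tendsto)
  moreover have "(\<lambda>n. m + 1 / real (Suc n)) \<longlonglongrightarrow> m + 0"
    by (intro tendsto_intros LIMSEQ_Suc lim_1_over_n)
  ultimately have Jz: "J z \<le> m"
    using x LIMSEQ_le[of "\<lambda>n. J (x n)" "J z" "\<lambda>n. m + 1 / real (Suc n)" "m + 0"]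
    by (auto intro: less_imp_le)
  have "f y = inner y z" for y
  proof (rule ccontr)
    define c where "c = inner y z - f y"
    assume "f y \<noteq> inner y z"
    then have c: "c \<noteq> 0" "y \<noteq> 0" by (auto simp: c_def zero)
    define t where "t = - c / (norm y)\<^sup>2"
    have "J (z + t *\<^sub>R y) = J z + t\<^sup>2 * (norm y)\<^sup>2 + 2 * t * c"
      unfolding J_def c_def scaleR add power2_norm_eq_inner
      by (simp add: inner_add_left inner_add_right inner_commute power2_eq_square algebra_simps)
    also have "\<dots> = J z - c\<^sup>2 / (norm y)\<^sup>2"
      using c by (simp add: t_def field_simps power2_eq_square)
    also have "\<dots> < J z" using c by simp
    finally show False using m_le[of "z + t *\<^sub>R y"] Jz by linarith
  qed
  then show ?thesis by (rule that)
qed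

text \<open>
  The value at \<open>y\<close> of the adjoint of \<open>T\<close>. It turns the condition \<open>cinner (T x) y = 0\<close> into
  orthogonality to a vector, so that it can be imposed together with ordinary orthogonality.
\<close>

lemma adjoint_vector:
  fixes T :: "'a::complex_hilbert \<Rightarrow> 'a"
  assumes T: "bounded_clinear T"
  obtains z where "\<And>x. cinner (T x) y = cinner x z"
proof -
  have "bounded_linear (\<lambda>x. Re (cinner (T x) y))"
    using T bounded_linear_compose[OF bounded_linear_cinner_left, of T y]
    unfolding bounded_clinear_def by (auto intro: bounded_linear_compose[OF bounded_linear_Re])
  then obtain z where "\<And>x. Re (cinner (T x) y) = inner x z"
    using Riesz_representation by blast
  then have re: "Re (cinner (T x) y) = Re (cinner x z)" for x by (simp add: inner_eq_Re_cinner)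
  have "cinner (T x) y = cinner x z" for x
    using re[of x] re[of "\<i> *\<^sub>C x"]
    by (simp add: complex_eq_iff bounded_clinear_scaleC[OF T] cinner_simps)
  then show ?thesis by (rule that)
qed

section \<open>Finite orthonormal sets\<close>

definition orthonormal_set :: "'a::complex_inner set \<Rightarrow> bool" where
  "orthonormal_set B \<longleftrightarrow> finite B \<and> (\<forall>a\<in>B. \<forall>b\<in>B. cinner a b = (if a = b then 1 else 0))"

definition perp :: "'a::complex_inner set \<Rightarrow> 'a set" where
  "perp G = {x. \<forall>y\<in>G. cinner x y = 0}"

definition proj :: "'a::complex_inner set \<Rightarrow> 'a \<Rightarrow> 'a" where
  "proj B x = (\<Sum>b\<in>B. cinner x b *\<^sub>C b)"

lemma perp_add: "x \<in> perp G \<Longrightarrow> y \<in> perp G \<Longrightarrow> x + y \<in> perp G"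
  by (simp add: perp_def cinner_simps)

lemma perp_diff: "x \<in> perp G \<Longrightarrow> y \<in> perp G \<Longrightarrow> x - y \<in> perp G"
  by (simp add: perp_def cinner_simps)

lemma perp_scaleC: "x \<in> perp G \<Longrightarrow> a *\<^sub>C x \<in> perp G"
  by (simp add: perp_def cinner_simps)

lemma perp_scaleR: "x \<in> perp G \<Longrightarrow> a *\<^sub>R x \<in> perp G"
  by (simp add: perp_def cinner_simps)

lemma perp_sum: "(\<And>i. i \<in> I \<Longrightarrow> f i \<in> perp G) \<Longrightarrow> sum f I \<in> perp G"
  by (simp add: perp_def cinner_sum_left)

lemma cinner_proj_member:
  assumes "orthonormal_set B" "b \<in> B"
  shows "cinner (proj B x) b = cinner x b"
proof -
  have "cinner (proj B x) b = (\<Sum>a\<in>B. if a = b then cinner x a else 0)"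
    using assms unfolding proj_def cinner_sum_left orthonormal_set_def
    by (intro sum.cong) (auto simp: cinner_simps)
  then show ?thesis using assms by (simp add: orthonormal_set_def)
qed

lemma diff_proj_perp: "orthonormal_set B \<Longrightarrow> x - proj B x \<in> perp B"
  by (simp add: perp_def cinner_simps cinner_proj_member)

lemma cinner_perp_proj: "x \<in> perp B \<Longrightarrow> cinner x (proj B y) = 0"
  by (simp add: perp_def proj_def cinner_sum_right cinner_simps)

lemma norm_proj_decomp:
  assumes "orthonormal_set B"
  shows "(norm x)\<^sup>2 = (norm (x - proj B x))\<^sup>2 + (norm (proj B x))\<^sup>2"
  using pythagoras[OF cinner_perp_proj[OF diff_proj_perp[OF assms]], of x x] by simp

lemma norm_diff_proj_le: "orthonormal_set B \<Longrightarrow> norm (x - proj B x) \<le> norm x"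
  using norm_proj_decomp[of B x] by (simp add: power2_le_imp_le)

lemma norm_proj_eq:
  assumes "orthonormal_set B"
  shows "(norm (proj B x))\<^sup>2 = (\<Sum>b\<in>B. (cmod (cinner x b))\<^sup>2)"
proof -
  have "cinner (proj B x) (proj B x) = (\<Sum>b\<in>B. cnj (cinner x b) * cinner (proj B x) b)"
    by (subst (2) proj_def) (simp add: cinner_sum_right cinner_simps)
  also have "\<dots> = (\<Sum>b\<in>B. complex_of_real ((cmod (cinner x b))\<^sup>2))"
    by (intro sum.cong) (auto simp: cinner_proj_member[OF assms] complex_norm_square mult.commute
        simp del: of_real_power)
  finally have "complex_of_real ((norm (proj B x))\<^sup>2) = complex_of_real (\<Sum>b\<in>B. (cmod (cinner x b))\<^sup>2)"
    by (simp add: cinner_self)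
  then show ?thesis by (simp only: of_real_eq_iff)
qed

lemma orthonormal_set_insert:
  assumes "orthonormal_set B" "x \<in> perp B" "norm x = 1"
  shows "orthonormal_set (insert x B)"
  using assms cinner_eq_zero_commute[of x] cinner_self[of x]
  by (auto simp: orthonormal_set_def perp_def)

text \<open>
  Gram--Schmidt. Only the orthogonal complement of the new set matters, because fresh vectors will
  be projected to it.
\<close>

lemma orthonormal_set_refining:
  assumes "finite G"
  shows "\<exists>B. orthonormal_set B \<and> perp B \<subseteq> perp G"
  using assms
proof (induction G rule: finite_induct)
  case empty
  show ?case by (rule exI[of _ "{}"]) (auto simp: orthonormal_set_def perp_def)
next
  case (insert a G)
  then obtain B where B: "orthonormal_set B" "perp B \<subseteq> perp G" by blast
  define r where "r = a - proj B a"
  define C where "C = (if r = 0 then B else insert ((1 / norm r) *\<^sub>R r) B)"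
  have r: "r \<in> perp B" unfolding r_def by (rule diff_proj_perp[OF B(1)])
  have "orthonormal_set C"
    using B(1) orthonormal_set_insert[OF B(1) perp_scaleR[OF r], of "1 / norm r"]
    by (auto simp: C_def)
  moreover have "x \<in> perp (insert a G)" if x: "x \<in> perp C" for x
  proof -
    have xB: "x \<in> perp B" using x by (auto simp: C_def perp_def split: if_splits)
    have "cinner x r = 0"
      using x by (auto simp: C_def perp_def cinner_simps split: if_splits)
    then have "cinner x a = 0"
      using cinner_perp_proj[OF xB, of a] by (simp add: r_def cinner_simps)
    then show ?thesis using xB B(2) by (auto simp: perp_def)
  qed
  ultimately show ?case by blast
qed

section \<open>The essential numerical range\<close>

lemma bounded_ess_num_range:
  assumes "bounded_clinear (T :: 'a::complex_hilbert \<Rightarrow> 'a)"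
  shows "bounded (ess_num_range T)"
proof -
  obtain K where K: "K > 0" "\<And>x. norm (T x) \<le> K * norm x" using bounded_clinear_bound[OF assms] by blast
  have "cmod z \<le> K" if z: "z \<in> ess_num_range T" for z
  proof -
    obtain e where e: "orthonormal_seq e" "(\<lambda>n. cinner (T (e n)) (e n)) \<longlonglongrightarrow> z"
      using z by (auto simp: ess_num_range_def)
    have "cmod (cinner (T (e n)) (e n)) \<le> K" if "n \<ge> 1" for n
    proof -
      have "norm (e n) = 1"
        using e(1) that by (simp add: orthonormal_seq_def norm_eq_1_cinner)
      then show ?thesis
        using cinner_Cauchy_Schwarz[of "T (e n)" "e n"] K(2)[of "e n"] by simp
    qed
    then show ?thesis
      by (intro LIMSEQ_le_const2[OF tendsto_norm[OF e(2)]]) auto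
  qed
  then show ?thesis by (auto simp: bounded_iff)
qed

text \<open>
  Otherwise unit vectors with value far from the essential numerical range could be found
  orthogonal to any finite orthonormal set. Stacking them gives an orthonormal sequence, and a
  limit point of its bounded sequence of values would be a point of the essential numerical range
  far from that range.
\<close>

lemma numerical_range_near_ess_num_range:
  fixes T :: "'a::complex_hilbert \<Rightarrow> 'a"
  assumes T: "bounded_clinear T" and \<eta>: "\<eta> > 0"
  obtains F where "orthonormal_set F"
    "\<And>x. x \<in> perp F \<Longrightarrow> norm x = 1 \<Longrightarrow> \<exists>w\<in>ess_num_range T. cmod (cinner (T x) x - w) < \<eta>"
proof (rule ccontr)
  assume *: "\<not> thesis"
  have "\<exists>x. orthonormal_set F \<longrightarrow> x \<in> perp F \<and> norm x = 1 \<and>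
      (\<forall>w\<in>ess_num_range T. \<eta> \<le> cmod (cinner (T x) x - w))" for F
    using * that[of F] by (meson not_le)
  then obtain b where b: "\<And>F. orthonormal_set F \<Longrightarrow> b F \<in> perp F \<and> norm (b F) = 1 \<and>
      (\<forall>w\<in>ess_num_range T. \<eta> \<le> cmod (cinner (T (b F)) (b F) - w))" by metis
  define F where "F = rec_nat {} (\<lambda>_ A. insert (b A) A)"
  have F_simps: "F 0 = {}" "\<And>n. F (Suc n) = insert (b (F n)) (F n)" by (auto simp: F_def)
  have ons: "orthonormal_set (F n)" for n
  proof (induction n)
    case 0
    show ?case by (simp add: F_simps orthonormal_set_def)
  next
    case (Suc n)
    then show ?case using b[OF Suc] by (simp add: F_simps orthonormal_set_insert)
  qed
  have mono: "m \<le> n \<Longrightarrow> F m \<subseteq> F n" for m n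
    by (rule lift_Suc_mono_le[of F]) (auto simp: F_simps)
  define x where "x n = b (F n)" for n
  have x: "x n \<in> perp (F n)" "norm (x n) = 1"
    "w \<in> ess_num_range T \<Longrightarrow> \<eta> \<le> cmod (cinner (T (x n)) (x n) - w)" for n w
    using b[OF ons[of n]] by (auto simp: x_def)
  have xx: "cinner (x n) (x m) = 0" if "m < n" for m n
  proof -
    have "x m \<in> F (Suc m)" by (simp add: x_def F_simps)
    then have "x m \<in> F n" using mono[of "Suc m" n] that by auto
    then show ?thesis using x(1)[of n] by (auto simp: perp_def)
  qed
  have x_on: "cinner (x m) (x n) = (if m = n then 1 else 0)" for m n
    using xx[of m n] xx[of n m] x(2)[of n] cinner_eq_zero_commute[of "x m" "x n"]
    by (cases m n rule: linorder_cases) (auto simp: cinner_self)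
  obtain K where K: "K > 0" "\<And>x. norm (T x) \<le> K * norm x" using bounded_clinear_bound[OF T] by blast
  have "cmod (cinner (T (x n)) (x n)) \<le> K" for n
    using cinner_Cauchy_Schwarz[of "T (x n)" "x n"] K(2)[of "x n"] x(2)[of n] by simp
  then have "bounded (range (\<lambda>n. cinner (T (x n)) (x n)))" by (auto simp: bounded_iff)
  then obtain w r where r: "strict_mono (r :: nat \<Rightarrow> nat)"
    and w: "((\<lambda>n. cinner (T (x n)) (x n)) \<circ> r) \<longlonglongrightarrow> w"
    using bounded_imp_convergent_subsequence by blast
  have "orthonormal_seq (x \<circ> r)"
    using strict_mono_eq[OF r] by (auto simp: orthonormal_seq_def x_on)
  then have "w \<in> ess_num_range T"
    using w by (auto simp: ess_num_range_def o_def)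
  then have "\<eta> \<le> cmod (cinner (T (x (r n))) (x (r n)) - w)" for n by (rule x(3))
  moreover have "(\<lambda>n. cmod (cinner (T (x (r n))) (x (r n)) - w)) \<longlonglongrightarrow> 0"
    using w by (intro tendsto_norm_zero LIM_zero) (simp add: o_def)
  ultimately have "\<eta> \<le> 0" by (intro LIMSEQ_le_const) auto
  then show False using \<eta> by simp
qed

lemma polarization_bound:
  assumes S: "bounded_clinear S"
    and small: "\<And>x. x \<in> perp F \<Longrightarrow> norm x = 1 \<Longrightarrow> cmod (cinner (S x) x) \<le> \<eta>"
    and x: "x \<in> perp F" and y: "y \<in> perp F"
  shows "cmod (cinner (S x) y) \<le> 2 * \<eta> * norm x * norm (y :: 'a::complex_inner)"
proof -
  have quad: "cmod (cinner (S z) z) \<le> \<eta> * (norm z)\<^sup>2" if "z \<in> perp F" for z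
  proof (cases "z = 0")
    case False
    define w where "w = (1 / norm z) *\<^sub>R z"
    have "norm w = 1" using False by (simp add: w_def)
    then have "cmod (cinner (S w) w) \<le> \<eta>"
      using perp_scaleR[OF that] by (intro small) (auto simp: w_def)
    moreover have "cinner (S w) w = cinner (S z) z / (norm z)\<^sup>2"
      by (simp add: w_def bounded_clinear_scaleR[OF S] cinner_simps power2_eq_square)
    ultimately show ?thesis
      using False by (simp add: norm_divide field_simps norm_power)
  qed (use bounded_clinear_scaleR[OF S, of 0 0] in simp)
  have unit: "cmod (cinner (S a) b) \<le> 2 * \<eta>"
    if ab: "a \<in> perp F" "b \<in> perp F" "norm a = 1" "norm b = 1" for a b
  proof -
    define q where "q z = cinner (S z) z" for z
    have "4 * cinner (S a) b = (q (a + b) - q (a - b)) + \<i> * (q (a + \<i> *\<^sub>C b) - q (a - \<i> *\<^sub>C b))"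
      unfolding q_def by (simp add: bounded_clinear_simps[OF S] cinner_simps algebra_simps)
    moreover have "cmod ((z1 - z2) + \<i> * (z3 - z4)) \<le> (cmod z1 + cmod z2) + (cmod z3 + cmod z4)"
      for z1 z2 z3 z4
      using norm_triangle_ineq[of "z1 - z2" "\<i> * (z3 - z4)"] norm_triangle_ineq4[of z1 z2]
        norm_triangle_ineq4[of z3 z4]
      by (simp add: norm_mult)
    ultimately have "cmod (4 * cinner (S a) b) \<le>
        (cmod (q (a + b)) + cmod (q (a - b))) + (cmod (q (a + \<i> *\<^sub>C b)) + cmod (q (a - \<i> *\<^sub>C b)))"
      by metis
    also have "\<dots> \<le> (\<eta> * (norm (a + b))\<^sup>2 + \<eta> * (norm (a - b))\<^sup>2) +
        (\<eta> * (norm (a + \<i> *\<^sub>C b))\<^sup>2 + \<eta> * (norm (a - \<i> *\<^sub>C b))\<^sup>2)"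
      unfolding q_def using ab
      by (intro add_mono quad perp_add perp_diff perp_scaleC)
    also have "\<dots> = \<eta> * (2 * (norm a)\<^sup>2 + 2 * (norm b)\<^sup>2) + \<eta> * (2 * (norm a)\<^sup>2 + 2 * (norm (\<i> *\<^sub>C b))\<^sup>2)"
      by (simp add: power2_norm_eq_inner inner_add_left inner_add_right inner_diff_left
          inner_diff_right algebra_simps)
    finally show ?thesis using ab by (simp add: norm_mult norm_scaleC)
  qed
  show ?thesis
  proof (cases "x = 0 \<or> y = 0")
    case True
    then show ?thesis using bounded_clinear_scaleR[OF S, of 0 0] by auto
  next
    case False
    have "cmod (cinner (S ((1 / norm x) *\<^sub>R x)) ((1 / norm y) *\<^sub>R y)) \<le> 2 * \<eta>"
      using False by (intro unit perp_scaleR x y) auto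
    then show ?thesis
      using False by (simp add: bounded_clinear_scaleR[OF S] cinner_simps norm_mult norm_divide field_simps)
  qed
qed

lemma compact_closure_approx:
  fixes A :: "'a::{real_normed_vector,complete_space} set"
  assumes "\<And>e. e > 0 \<Longrightarrow> \<exists>C. compact C \<and> (\<forall>x\<in>A. \<exists>y\<in>C. dist x y < e)"
  shows "compact (closure A)"
  unfolding compact_eq_totally_bounded
proof (intro conjI allI impI)
  show "complete (closure A)" by (simp add: complete_eq_closed)
  fix e :: real assume e: "e > 0"
  then obtain C where C: "compact C" "\<And>x. x \<in> A \<Longrightarrow> \<exists>y\<in>C. dist x y < e / 3"
    using assms[of "e / 3"] by auto
  obtain k where k: "finite k" "C \<subseteq> (\<Union>x\<in>k. ball x (e / 3))"
    using C(1) e unfolding compact_eq_totally_bounded by (metis divide_pos_pos zero_less_numeral)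
  have "closure A \<subseteq> (\<Union>x\<in>k. ball x e)"
  proof
    fix x assume "x \<in> closure A"
    then obtain a where a: "a \<in> A" "dist a x < e / 3"
      using e by (metis closure_approachable divide_pos_pos zero_less_numeral)
    obtain y where y: "y \<in> C" "dist a y < e / 3" using C(2)[OF a(1)] by blast
    obtain z where z: "z \<in> k" "dist z y < e / 3" using y(1) k(2) by auto
    have "dist z x < e"
      using a(2) y(2) z(2) dist_triangle[of z x y] dist_triangle[of y x a]
      by (simp add: dist_commute)
    then show "x \<in> (\<Union>x\<in>k. ball x e)" using z(1) by auto
  qed
  then show "\<exists>k. finite k \<and> closure A \<subseteq> (\<Union>x\<in>k. ball x e)" using k(1) by blast
qed

text \<open>
  Bounded sets in the range of a finite-rank map are relatively compact.
\<close>

lemma compact_bounded_combinations: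
  fixes g :: "'i \<Rightarrow> 'a::complex_inner"
  assumes "finite I"
  shows "\<exists>C. compact C \<and> (\<forall>c. (\<forall>i\<in>I. cmod (c i) \<le> M) \<longrightarrow> (\<Sum>i\<in>I. c i *\<^sub>C g i) \<in> C)"
  using assms
proof (induction I rule: finite_induct)
  case empty
  show ?case by (rule exI[of _ "{0}"]) simp
next
  case (insert j I)
  then obtain C where C: "compact C" "\<And>c. (\<forall>i\<in>I. cmod (c i) \<le> M) \<Longrightarrow> (\<Sum>i\<in>I. c i *\<^sub>C g i) \<in> C"
    by blast
  have "bounded_linear (\<lambda>c. c *\<^sub>C g j)"
    by (rule bounded_linear_intro[where K = "norm (g j)"])
      (auto simp: scaleC_add_left norm_scaleC scaleR_eq_scaleC scaleC_scaleC scaleR_conv_of_real)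
  then have "compact ((\<lambda>c. c *\<^sub>C g j) ` cball 0 M)"
    by (intro compact_continuous_image linear_continuous_on) auto
  then have "compact {x + y |x y. x \<in> (\<lambda>c. c *\<^sub>C g j) ` cball 0 M \<and> y \<in> C}"
    using C(1) by (rule compact_sums)
  moreover have "(\<Sum>i\<in>insert j I. c i *\<^sub>C g i) \<in> {x + y |x y. x \<in> (\<lambda>c. c *\<^sub>C g j) ` cball 0 M \<and> y \<in> C}"
    if "\<forall>i\<in>insert j I. cmod (c i) \<le> M" for c
  proof -
    have "c j *\<^sub>C g j \<in> (\<lambda>c. c *\<^sub>C g j) ` cball 0 M" using that by (intro imageI) simp
    moreover have "(\<Sum>i\<in>I. c i *\<^sub>C g i) \<in> C" using that by (intro C(2)) simp
    ultimately show ?thesis using insert.hyps by auto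
  qed
  ultimately show ?case by blast
qed

text \<open>
  With \<open>P = proj F\<close>, the operator \<open>S = T - z\<close> splits into \<open>P S + (1 - P) S P\<close>, which has finite
  rank, and \<open>(1 - P) S (1 - P)\<close>, which is small by polarization once \<open>F\<close> is large. So the image of
  the unit ball is close to compact sets.
\<close>

lemma compact_operator_if_ess_num_range_singleton:
  fixes T :: "'a::complex_hilbert \<Rightarrow> 'a"
  assumes T: "bounded_clinear T" and W: "ess_num_range T \<subseteq> {z}"
  shows "compact_operator (\<lambda>x. T x - z *\<^sub>C x)"
proof -
  define S where "S x = T x - z *\<^sub>C x" for x
  have S: "bounded_clinear S" unfolding S_def[abs_def] by (rule bounded_clinear_shift[OF T])
  obtain K where K: "K > 0" "\<And>x. norm (S x) \<le> K * norm x" using bounded_clinear_bound[OF S] by blast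
  have "compact (closure (S ` cball 0 1))"
  proof (rule compact_closure_approx)
    fix e :: real assume e: "e > 0"
    obtain F where F: "orthonormal_set F"
      "\<And>x. x \<in> perp F \<Longrightarrow> norm x = 1 \<Longrightarrow> \<exists>w\<in>ess_num_range T. cmod (cinner (T x) x - w) < e / 4"
      using numerical_range_near_ess_num_range[OF T, of "e / 4"] e by auto
    have "cmod (cinner (S x) x) \<le> e / 4" if "x \<in> perp F" "norm x = 1" for x
      using F(2)[OF that] W that(2) by (auto simp: S_def cinner_simps cinner_self)
    then have ess: "cmod (cinner (S x) y) \<le> 2 * (e / 4) * norm x * norm y"
      if "x \<in> perp F" "y \<in> perp F" for x y
      using polarization_bound[OF S _ that, of "e / 4"] by blast
    have fin: "finite F" using F(1) by (simp add: orthonormal_set_def)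
    have unit: "norm b = 1" if "b \<in> F" for b
      using F(1) that by (simp add: orthonormal_set_def norm_eq_1_cinner)
    obtain C1 where C1: "compact C1" "\<And>c. (\<forall>b\<in>F. cmod (c b) \<le> K) \<Longrightarrow> (\<Sum>b\<in>F. c b *\<^sub>C b) \<in> C1"
      using compact_bounded_combinations[OF fin, of K "\<lambda>b. b"] by blast
    obtain C2 where C2: "compact C2"
      "\<And>c. (\<forall>b\<in>F. cmod (c b) \<le> 1) \<Longrightarrow> (\<Sum>b\<in>F. c b *\<^sub>C (S b - proj F (S b))) \<in> C2"
      using compact_bounded_combinations[OF fin, of 1 "\<lambda>b. S b - proj F (S b)"] by blast
    have "\<exists>y\<in>{p + q |p q. p \<in> C1 \<and> q \<in> C2}. dist (S x) y < e" if x: "norm x \<le> 1" for x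
    proof -
      \<comment> \<open>\<open>p\<close> and \<open>q\<close> are the two finite-rank parts, \<open>w\<close> is the remainder off \<open>F\<close>\<close>
      define p where "p = proj F (S x)"
      define q where "q = S (proj F x) - proj F (S (proj F x))"
      define w where "w = S (x - proj F x) - proj F (S (x - proj F x))"
      have proj_add: "proj F (a + b) = proj F a + proj F b" for a b
        by (simp add: proj_def cinner_simps scaleC_add_left sum.distrib)
      have proj_scale: "proj F (c *\<^sub>C a) = c *\<^sub>C proj F a" for c a
        by (simp add: proj_def cinner_simps complex_vector.scale_sum_right scaleC_scaleC)
      have proj_sum: "proj F (\<Sum>b\<in>F. h b) = (\<Sum>b\<in>F. proj F (h b))" for h
        unfolding proj_def cinner_sum_left complex_vector.scale_sum_left by (rule sum.swap)
      have "S x = S (proj F x) + S (x - proj F x)"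
        by (simp add: bounded_clinear_diff[OF S])
      moreover from this have "p = proj F (S (proj F x)) + proj F (S (x - proj F x))"
        by (metis p_def proj_add)
      ultimately have Sx: "S x = p + q + w" by (simp add: q_def w_def)
      have "p \<in> C1" unfolding p_def proj_def
      proof (intro C1 ballI)
        fix b assume "b \<in> F"
        have "cmod (cinner (S x) b) \<le> norm (S x)"
          using cinner_Cauchy_Schwarz[of "S x" b] unit[OF \<open>b \<in> F\<close>] by simp
        also have "\<dots> \<le> K * norm x" by (rule K)
        also have "\<dots> \<le> K" using x K(1) by simp
        finally show "cmod (cinner (S x) b) \<le> K" .
      qed
      moreover have "q = (\<Sum>b\<in>F. cinner x b *\<^sub>C (S b - proj F (S b)))"
        unfolding q_def
        by (simp add: proj_def[of F x] bounded_clinear_sum[OF S] bounded_clinear_scaleC[OF S]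
            proj_sum proj_scale complex_vector.scale_right_diff_distrib sum_subtractf)
      moreover have "(\<Sum>b\<in>F. cinner x b *\<^sub>C (S b - proj F (S b))) \<in> C2"
      proof (intro C2 ballI)
        fix b assume "b \<in> F"
        then show "cmod (cinner x b) \<le> 1"
          using cinner_Cauchy_Schwarz[of x b] unit[OF \<open>b \<in> F\<close>] x by simp
      qed
      ultimately have "p + q \<in> {p + q |p q. p \<in> C1 \<and> q \<in> C2}" by auto
      moreover have "norm w \<le> e / 2"
      proof (cases "w = 0")
        case False
        have xF: "x - proj F x \<in> perp F" and wF: "w \<in> perp F"
          unfolding w_def by (rule diff_proj_perp[OF F(1)])+
        have "cinner (S (x - proj F x)) w = cinner w w"
          using cinner_perp_proj[OF wF, of "S (x - proj F x)"]
          by (subst (2) w_def) (simp add: cinner_simps cinner_eq_zero_commute)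
        then have "(norm w)\<^sup>2 = cmod (cinner (S (x - proj F x)) w)" by (simp add: cinner_self norm_power)
        also have "\<dots> \<le> 2 * (e / 4) * norm (x - proj F x) * norm w" by (rule ess[OF xF wF])
        also have "\<dots> \<le> 2 * (e / 4) * 1 * norm w"
          using norm_diff_proj_le[OF F(1), of x] x e by (intro mult_right_mono mult_left_mono) auto
        finally have "norm w * norm w \<le> (e / 2) * norm w" by (simp add: power2_eq_square)
        then show ?thesis using False by simp
      qed (use e in simp)
      ultimately show ?thesis
        using e Sx by (intro bexI[of _ "p + q"]) (auto simp: dist_norm)
    qed
    then show "\<exists>C. compact C \<and> (\<forall>x\<in>S ` cball 0 1. \<exists>y\<in>C. dist x y < e)"
      using compact_sums[OF C1(1) C2(1)] by (intro exI[of _ "{p + q |p q. p \<in> C1 \<and> q \<in> C2}"]) auto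
  qed
  then show ?thesis using S by (simp add: compact_operator_def S_def[abs_def])
qed

section \<open>Fresh vectors\<close>

text \<open>
  Bessel's inequality makes the squared coefficients summable.
\<close>

lemma orthonormal_seq_weakly_null:
  assumes e: "orthonormal_seq e"
  shows "(\<lambda>n. cinner (e n) (b :: 'a::complex_inner)) \<longlonglongrightarrow> 0"
proof -
  have ee: "cinner (e m) (e n) = (if m = n then 1 else 0)" if "m \<ge> 1" "n \<ge> 1" for m n
    using e that by (simp add: orthonormal_seq_def)
  have inj: "inj_on e {1..N}" for N
  proof (rule inj_onI)
    fix m n assume mn: "m \<in> {1..N}" "n \<in> {1..N}" "e m = e n"
    then have "cinner (e m) (e n) = 1" using ee[of n n] by simp
    then show "m = n" using ee[of m n] mn by (auto split: if_splits)
  qed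
  have Bessel: "(\<Sum>n\<in>{1..N}. (cmod (cinner b (e n)))\<^sup>2) \<le> (norm b)\<^sup>2" for N
  proof -
    have ons: "orthonormal_set (e ` {1..N})"
      using ee inj[of N] by (auto simp: orthonormal_set_def inj_on_eq_iff)
    have "(\<Sum>n\<in>{1..N}. (cmod (cinner b (e n)))\<^sup>2) = (norm (proj (e ` {1..N}) b))\<^sup>2"
      unfolding norm_proj_eq[OF ons] sum.reindex[OF inj] by simp
    also have "\<dots> \<le> (norm b)\<^sup>2" using norm_proj_decomp[OF ons, of b] by simp
    finally show ?thesis .
  qed
  have "summable (\<lambda>n. (cmod (cinner b (e (Suc n))))\<^sup>2)"
  proof (rule summableI_nonneg_bounded)
    fix N
    have "(\<Sum>n<N. (cmod (cinner b (e (Suc n))))\<^sup>2) = (\<Sum>n\<in>{1..N}. (cmod (cinner b (e n)))\<^sup>2)"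
      by (rule sum.reindex_bij_witness[of _ "\<lambda>n. n - 1" Suc]) auto
    then show "(\<Sum>n<N. (cmod (cinner b (e (Suc n))))\<^sup>2) \<le> (norm b)\<^sup>2" using Bessel[of N] by simp
  qed simp
  then have "(\<lambda>n. (cmod (cinner b (e (Suc n))))\<^sup>2) \<longlonglongrightarrow> 0" by (rule summable_LIMSEQ_zero)
  then have "(\<lambda>n. sqrt ((cmod (cinner b (e (Suc n))))\<^sup>2)) \<longlonglongrightarrow> sqrt 0" by (rule tendsto_real_sqrt)
  then have "(\<lambda>n. cmod (cinner b (e n))) \<longlonglongrightarrow> 0" by (simp add: filterlim_sequentially_Suc[of "\<lambda>n. cmod (cinner b (e n))"])
  moreover have "cmod (cinner b (e n)) = norm (cinner (e n) b)" for n
    by (subst cinner_commute) simp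
  ultimately show ?thesis by (simp add: tendsto_norm_zero_iff)
qed

text \<open>
  An orthonormal sequence \<open>e\<close> realizing \<open>z\<close> is weakly null, so its projections to a
  finite-dimensional space tend to \<open>0\<close> in norm. Removing them and normalizing costs nothing in the
  limit.
\<close>

lemma ess_num_range_approx_perp:
  fixes T :: "'a::complex_hilbert \<Rightarrow> 'a"
  assumes T: "bounded_clinear T" and z: "z \<in> ess_num_range T" and G: "finite G" and \<eta>: "\<eta> > 0"
  obtains x where "x \<in> perp G" "norm x = 1" "cmod (cinner (T x) x - z) < \<eta>"
proof -
  obtain B where B: "orthonormal_set B" "perp B \<subseteq> perp G"
    using orthonormal_set_refining[OF G] by blast
  obtain e where e: "orthonormal_seq e" "(\<lambda>n. cinner (T (e n)) (e n)) \<longlonglongrightarrow> z"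
    using z by (auto simp: ess_num_range_def)
  have e1: "norm (e n) = 1" if "n \<ge> 1" for n
    using e(1) that by (simp add: orthonormal_seq_def norm_eq_1_cinner)
  obtain K where K: "K > 0" "\<And>x. norm (T x) \<le> K * norm x"
    using bounded_clinear_bound[OF T] by blast
  define a where "a n = proj B (e n)" for n
  define d where "d n = e n - a n" for n
  have "(\<lambda>n. proj B (e n)) \<longlonglongrightarrow> (\<Sum>b\<in>B. 0)"
    unfolding proj_def
  proof (rule tendsto_sum)
    fix b assume "b \<in> B"
    have "(\<lambda>n. cmod (cinner (e n) b) * norm b) \<longlonglongrightarrow> 0"
      by (rule tendsto_mult_left_zero[OF tendsto_norm_zero[OF orthonormal_seq_weakly_null[OF e(1)]]])
    then have "(\<lambda>n. norm (cinner (e n) b *\<^sub>C b)) \<longlonglongrightarrow> 0" by (simp only: norm_scaleC)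
    then show "(\<lambda>n. cinner (e n) b *\<^sub>C b) \<longlonglongrightarrow> 0" by (rule tendsto_norm_zero_cancel)
  qed
  then have a0: "a \<longlonglongrightarrow> 0" by (simp add: a_def[abs_def])
  have ev1: "eventually (\<lambda>n. n \<ge> (1::nat)) sequentially" by (rule eventually_ge_at_top)
  have "(\<lambda>n. norm (d n) - 1) \<longlonglongrightarrow> 0"
  proof (rule Lim_null_comparison[OF _ tendsto_norm_zero[OF a0]])
    show "\<forall>\<^sub>F n in sequentially. norm (norm (d n) - 1) \<le> norm (a n)"
      using ev1
    proof eventually_elim
      case (elim n)
      then show ?case
        using norm_triangle_ineq3[of "d n" "e n"] e1[of n] by (simp add: d_def)
    qed
  qed
  then have d1: "(\<lambda>n. norm (d n)) \<longlonglongrightarrow> 1" by (rule LIM_zero_cancel)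
  have "(\<lambda>n. cinner (T (d n)) (d n) - cinner (T (e n)) (e n)) \<longlonglongrightarrow> 0"
  proof (rule Lim_null_comparison)
    show "\<forall>\<^sub>F n in sequentially. norm (cinner (T (d n)) (d n) - cinner (T (e n)) (e n)) \<le> 2 * K * norm (a n)"
      using ev1
    proof eventually_elim
      case (elim n)
      have dn: "norm (d n) \<le> 1"
        using norm_diff_proj_le[OF B(1), of "e n"] e1[OF elim] by (simp add: d_def a_def)
      have "cinner (T (d n)) (d n) - cinner (T (e n)) (e n) = - cinner (T (a n)) (d n) - cinner (T (e n)) (a n)"
        by (simp add: d_def bounded_clinear_diff[OF T] cinner_simps)
      also have "cmod \<dots> \<le> cmod (cinner (T (a n)) (d n)) + cmod (cinner (T (e n)) (a n))"
        using norm_triangle_ineq4[of "- cinner (T (a n)) (d n)" "cinner (T (e n)) (a n)"] by simp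
      also have "\<dots> \<le> K * norm (a n) * 1 + K * 1 * norm (a n)"
        using cinner_Cauchy_Schwarz[of "T (a n)" "d n"] cinner_Cauchy_Schwarz[of "T (e n)" "a n"]
          mult_mono[OF K(2)[of "a n"] dn] mult_right_mono[OF K(2)[of "e n"], of "norm (a n)"] K(1) e1[OF elim]
        by simp
      finally show ?case by simp
    qed
    show "(\<lambda>n. 2 * K * norm (a n)) \<longlonglongrightarrow> 0" using tendsto_mult_right_zero[OF tendsto_norm_zero[OF a0]] .
  qed
  from tendsto_add[OF this e(2)] have "(\<lambda>n. cinner (T (d n)) (d n)) \<longlonglongrightarrow> z" by simp
  then have "(\<lambda>n. cinner (T (d n)) (d n) / complex_of_real ((norm (d n))\<^sup>2)) \<longlonglongrightarrow> z / complex_of_real (1\<^sup>2)"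
    by (intro tendsto_intros d1) auto
  then have "\<forall>\<^sub>F n in sequentially. dist (cinner (T (d n)) (d n) / complex_of_real ((norm (d n))\<^sup>2)) z < \<eta>"
    using \<eta> by (auto dest: tendstoD)
  moreover have "\<forall>\<^sub>F n in sequentially. norm (d n) > 0" by (rule order_tendstoD(1)[OF d1]) simp
  ultimately have "\<forall>\<^sub>F n in sequentially. dist (cinner (T (d n)) (d n) / complex_of_real ((norm (d n))\<^sup>2)) z < \<eta> \<and> norm (d n) > 0"
    by (rule eventually_conj)
  then obtain n where n: "dist (cinner (T (d n)) (d n) / complex_of_real ((norm (d n))\<^sup>2)) z < \<eta>" "norm (d n) > 0"
    using eventually_happens by fastforce
  show ?thesis
  proof (rule that)
    have "d n \<in> perp G" using diff_proj_perp[OF B(1)] B(2) by (auto simp: d_def a_def)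
    then show "(1 / norm (d n)) *\<^sub>R d n \<in> perp G" by (rule perp_scaleR)
    show "norm ((1 / norm (d n)) *\<^sub>R d n) = 1" using n(2) by simp
    show "cmod (cinner (T ((1 / norm (d n)) *\<^sub>R d n)) ((1 / norm (d n)) *\<^sub>R d n) - z) < \<eta>"
      using n(1) by (simp add: bounded_clinear_scaleR[OF T] cinner_simps dist_norm power2_eq_square)
  qed
qed

lemma ess_num_range_approx_fresh:
  fixes T :: "'a::complex_hilbert \<Rightarrow> 'a"
  assumes T: "bounded_clinear T" and z: "z \<in> ess_num_range T" and G: "finite G" and \<eta>: "\<eta> > 0"
  obtains x where "norm x = 1" "cmod (cinner (T x) x - z) < \<eta>"
    "\<And>y. y \<in> G \<Longrightarrow> cinner x y = 0 \<and> cinner x (T y) = 0 \<and> cinner (T x) y = 0"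
proof -
  have "\<forall>y. \<exists>w. \<forall>x. cinner (T x) y = cinner x w" using adjoint_vector[OF T] by metis
  then obtain A where A: "\<And>x y. cinner (T x) y = cinner x (A y)" by metis
  have fin: "finite (G \<union> T ` G \<union> A ` G)" using G by simp
  obtain x where "x \<in> perp (G \<union> T ` G \<union> A ` G)" "norm x = 1" "cmod (cinner (T x) x - z) < \<eta>"
    by (rule ess_num_range_approx_perp[OF T z fin \<eta>])
  then show ?thesis by (intro that[of x]) (auto simp: perp_def A)
qed

text \<open>
  Unit vectors \<open>e\<close>, \<open>f\<close> that are fresh and not coupled by \<open>T\<close>, with values near \<open>\<alpha>\<close> and \<open>\<mu>\<close>, span
  a plane on which \<open>T\<close> is diagonal but far from scalar. Rotating them by the \<open>3\<close>-\<open>4\<close>-\<open>5\<close> angle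
  makes both off-diagonal entries equal to \<open>12 / 25\<close> of the difference of the two values, and
  puts the diagonal entry at \<open>v\<close> near \<open>(16 * \<alpha> + 9 * \<mu>) / 25\<close>. Equality of the two couplings is
  what serves \<open>T\<close> and its adjoint at the same time.
\<close>

lemma fresh_pair:
  fixes T :: "'a::complex_hilbert \<Rightarrow> 'a"
  assumes T: "bounded_clinear T" and "\<alpha> \<in> ess_num_range T" and "\<mu> \<in> ess_num_range T"
    and \<delta>: "\<delta> > 0" and gap: "\<delta> / 2 \<le> cmod (\<alpha> - \<mu>)"
    and mean: "7 * \<delta> / 100 \<le> cmod ((16 * \<alpha> + 9 * \<mu>) / 25)"
    and G: "finite G"
  defines "S \<equiv> \<lambda>x. T x - \<alpha> *\<^sub>C x"
  obtains v t where "norm v = 1" "norm t = 1" "cinner v t = 0"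
    "\<And>y. y \<in> G \<Longrightarrow> cinner v y = 0 \<and> cinner v (S y) = 0 \<and> cinner (S v) y = 0"
    "\<And>y. y \<in> G \<Longrightarrow> cinner t y = 0 \<and> cinner t (S y) = 0 \<and> cinner (S t) y = 0"
    "cinner (S t) v = cinner (S v) t"
    "23 * \<delta> / 100 \<le> cmod (cinner (S v) t)"
    "6 * \<delta> / 100 \<le> cmod (\<alpha> + cinner (S v) v)"
proof -
  have \<eta>: "\<delta> / 100 > 0" using \<delta> by simp
  obtain e where e: "norm e = 1" "cmod (cinner (T e) e - \<alpha>) < \<delta> / 100"
    "\<And>y. y \<in> G \<Longrightarrow> cinner e y = 0 \<and> cinner e (T y) = 0 \<and> cinner (T e) y = 0"
    by (rule ess_num_range_approx_fresh[OF T assms(2) G \<eta>]) blast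
  have G': "finite (insert e G)" using G by simp
  obtain f where f: "norm f = 1" "cmod (cinner (T f) f - \<mu>) < \<delta> / 100"
    "\<And>y. y \<in> insert e G \<Longrightarrow> cinner f y = 0 \<and> cinner f (T y) = 0 \<and> cinner (T f) y = 0"
    by (rule ess_num_range_approx_fresh[OF T assms(3) G' \<eta>]) blast
  define a b where "a = cinner (T e) e" and "b = cinner (T f) f"
  have prods: "cinner e e = 1" "cinner f f = 1" "cinner f e = 0" "cinner e f = 0"
    "cinner (T f) e = 0" "cinner (T e) f = 0"
    using e f cinner_eq_zero_commute[of f] by (auto simp: norm_eq_1_cinner)
  define v where "v = (4/5) *\<^sub>R e + (3/5) *\<^sub>R f"
  define t where "t = (4/5) *\<^sub>R f - (3/5) *\<^sub>R e"
  have Tv: "T v = (4/5) *\<^sub>R T e + (3/5) *\<^sub>R T f" and Tt: "T t = (4/5) *\<^sub>R T f - (3/5) *\<^sub>R T e"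
    by (simp_all add: v_def t_def bounded_clinear_simps[OF T])
  have Svt: "cinner (S v) t = 12 / 25 * (b - a)" "cinner (S t) v = 12 / 25 * (b - a)"
    and Svv: "\<alpha> + cinner (S v) v = (16 * a + 9 * b) / 25"
    unfolding S_def Tv Tt by (simp_all add: v_def t_def cinner_simps prods a_def b_def field_simps)
  show ?thesis
  proof (rule that)
    show "norm v = 1" "norm t = 1" "cinner v t = 0"
      unfolding norm_eq_1_cinner v_def t_def by (simp_all add: cinner_simps prods)
    show "cinner v y = 0 \<and> cinner v (S y) = 0 \<and> cinner (S v) y = 0" if "y \<in> G" for y
      using e(3)[OF that] f(3)[of y] that unfolding S_def Tv by (simp add: v_def cinner_simps)
    show "cinner t y = 0 \<and> cinner t (S y) = 0 \<and> cinner (S t) y = 0" if "y \<in> G" for y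
      using e(3)[OF that] f(3)[of y] that unfolding S_def Tt by (simp add: t_def cinner_simps)
    show "cinner (S t) v = cinner (S v) t" by (simp add: Svt)
    have "cmod (\<alpha> - \<mu>) \<le> cmod (b - a) + cmod (a - \<alpha>) + cmod (b - \<mu>)"
      using norm_triangle_ineq4[of "(b - a) + (a - \<alpha>)" "b - \<mu>"] norm_triangle_ineq[of "b - a" "a - \<alpha>"]
      by (simp add: norm_minus_commute)
    then have "48 * \<delta> / 100 \<le> cmod (b - a)" using gap e(2) f(2) by (simp add: a_def b_def)
    moreover have "cmod (12 / 25 * (b - a)) = 12 / 25 * cmod (b - a)"
      by (simp only: norm_mult) simp
    ultimately show "23 * \<delta> / 100 \<le> cmod (cinner (S v) t)" using \<delta> by (simp only: Svt)
    have "(16 * \<alpha> + 9 * \<mu>) / 25 - (16 * a + 9 * b) / 25 = - (16 / 25 * (a - \<alpha>) + 9 / 25 * (b - \<mu>))"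
      by (simp add: field_simps)
    then have "cmod ((16 * \<alpha> + 9 * \<mu>) / 25 - (16 * a + 9 * b) / 25) =
        cmod (16 / 25 * (a - \<alpha>) + 9 / 25 * (b - \<mu>))"
      by (simp only: norm_minus_cancel)
    also have "\<dots> \<le> cmod (16 / 25 * (a - \<alpha>)) + cmod (9 / 25 * (b - \<mu>))" by (rule norm_triangle_ineq)
    also have "\<dots> = 16 / 25 * cmod (a - \<alpha>) + 9 / 25 * cmod (b - \<mu>)" by (simp only: norm_mult) simp
    finally have "cmod ((16 * \<alpha> + 9 * \<mu>) / 25 - (16 * a + 9 * b) / 25) \<le>
        16 / 25 * cmod (a - \<alpha>) + 9 / 25 * cmod (b - \<mu>)" .
    then show "6 * \<delta> / 100 \<le> cmod (\<alpha> + cinner (S v) v)"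
      using mean e(2) f(2) norm_triangle_ineq2[of "(16 * \<alpha> + 9 * \<mu>) / 25" "(16 * a + 9 * b) / 25"]
      unfolding Svv a_def[symmetric] b_def[symmetric] by argo
  qed
qed

lemma diameter_ess_num_range_pos:
  fixes T :: "'a::complex_hilbert \<Rightarrow> 'a"
  assumes T: "bounded_clinear T"
    and nc: "\<not> (\<exists>z K. compact_operator K \<and> T = (\<lambda>x. z *\<^sub>C x + K x))"
  shows "0 < diameter (ess_num_range T)"
proof -
  have not_single: "\<not> ess_num_range T \<subseteq> {z}" for z
  proof
    assume "ess_num_range T \<subseteq> {z}"
    then have "compact_operator (\<lambda>x. T x - z *\<^sub>C x)"
      by (rule compact_operator_if_ess_num_range_singleton[OF T])
    moreover have "T = (\<lambda>x. z *\<^sub>C x + (T x - z *\<^sub>C x))" by auto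
    ultimately show False using nc by blast
  qed
  obtain \<alpha> where \<alpha>: "\<alpha> \<in> ess_num_range T" using not_single[of 0] by blast
  obtain \<mu> where \<mu>: "\<mu> \<in> ess_num_range T" "\<mu> \<noteq> \<alpha>" using not_single[of \<alpha>] by blast
  have "0 < dist \<alpha> \<mu>" using \<mu>(2) by auto
  also have "\<dots> \<le> diameter (ess_num_range T)"
    by (rule diameter_bounded_bound[OF bounded_ess_num_range[OF T] \<alpha> \<mu>(1)])
  finally show ?thesis .
qed

text \<open>
  The weighted means with weights \<open>16 : 9\<close> and \<open>9 : 16\<close> of two points differ by \<open>7 / 25\<close> of their
  distance, so one of the two is away from \<open>0\<close>. This keeps the diagonal entries away from \<open>0\<close>.
\<close>

lemma ess_num_range_spread_pair:
  fixes T :: "'a::complex_hilbert \<Rightarrow> 'a"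
  assumes T: "bounded_clinear T" and \<delta>: "\<delta> = diameter (ess_num_range T)" "\<delta> > 0"
  obtains \<alpha> \<mu> where "\<alpha> \<in> ess_num_range T" "\<mu> \<in> ess_num_range T" "\<delta> / 2 \<le> cmod (\<alpha> - \<mu>)"
    "7 * \<delta> / 100 \<le> cmod ((16 * \<alpha> + 9 * \<mu>) / 25)"
proof -
  obtain z w where zw: "z \<in> ess_num_range T" "w \<in> ess_num_range T" "\<delta> / 2 < cmod (z - w)"
    using diameter_lower_bounded[OF bounded_ess_num_range[OF T], of "\<delta> / 2"] \<delta> by (auto simp: dist_norm)
  have "(16 * z + 9 * w) / 25 - (16 * w + 9 * z) / 25 = 7 / 25 * (z - w)" by (simp add: field_simps)
  moreover have "cmod (7 / 25 * (z - w)) = 7 / 25 * cmod (z - w)"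
    by (simp only: norm_mult) simp
  ultimately have "cmod ((16 * z + 9 * w) / 25 - (16 * w + 9 * z) / 25) = 7 / 25 * cmod (z - w)"
    by (simp only:)
  then have "7 / 25 * cmod (z - w) \<le> cmod ((16 * z + 9 * w) / 25) + cmod ((16 * w + 9 * z) / 25)"
    using norm_triangle_ineq4[of "(16 * z + 9 * w) / 25" "(16 * w + 9 * z) / 25"] by simp
  then consider "7 * \<delta> / 100 \<le> cmod ((16 * z + 9 * w) / 25)" | "7 * \<delta> / 100 \<le> cmod ((16 * w + 9 * z) / 25)"
    using zw(3) by argo
  then show ?thesis
  proof cases
    case 1
    then show ?thesis using that[of z w] zw by simp
  next
    case 2
    then show ?thesis using that[of w z] zw by (simp add: norm_minus_commute)
  qed
qed

text \<open>
  This bound by \<open>\<delta>\<close>, rather than by the norm of \<open>T\<close>, is the source of constants that depend on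
  the diameter only.
\<close>

lemma essentially_small_shift:
  fixes T :: "'a::complex_hilbert \<Rightarrow> 'a"
  assumes T: "bounded_clinear T" and \<delta>: "\<delta> = diameter (ess_num_range T)" "\<delta> > 0"
    and \<alpha>: "\<alpha> \<in> ess_num_range T"
  obtains F where "finite F"
    "\<And>x y. x \<in> perp F \<Longrightarrow> y \<in> perp F \<Longrightarrow>
      cmod (cinner (T x - \<alpha> *\<^sub>C x) y) \<le> 4 * \<delta> * norm x * norm y"
proof -
  obtain F where F: "orthonormal_set F"
    "\<And>x. x \<in> perp F \<Longrightarrow> norm x = 1 \<Longrightarrow> \<exists>w\<in>ess_num_range T. cmod (cinner (T x) x - w) < \<delta>"
    using numerical_range_near_ess_num_range[OF T \<delta>(2)] by blast
  have "cmod (cinner (T x - \<alpha> *\<^sub>C x) x) \<le> 2 * \<delta>" if x: "x \<in> perp F" "norm x = 1" for x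
  proof -
    obtain w where w: "w \<in> ess_num_range T" "cmod (cinner (T x) x - w) < \<delta>" using F(2)[OF x] by blast
    have "cmod (w - \<alpha>) \<le> \<delta>"
      using diameter_bounded_bound[OF bounded_ess_num_range[OF T] w(1) \<alpha>] \<delta> by (simp add: dist_norm)
    then have "cmod (cinner (T x) x - \<alpha>) \<le> 2 * \<delta>"
      using w(2) norm_triangle_ineq[of "cinner (T x) x - w" "w - \<alpha>"] by simp
    then show ?thesis using x(2) by (simp add: cinner_simps norm_eq_1_cinner)
  qed
  then have "cmod (cinner (T x - \<alpha> *\<^sub>C x) y) \<le> 2 * (2 * \<delta>) * norm x * norm y"
    if "x \<in> perp F" "y \<in> perp F" for x y
    using polarization_bound[OF bounded_clinear_shift[OF T], of F \<alpha> "2 * \<delta>" x y] that by blast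
  then show ?thesis using F(1) by (intro that[of F]) (auto simp: orthonormal_set_def)
qed

section \<open>Avoiding discs\<close>

text \<open>
  Among \<open>card I + 1\<close> real numbers spaced by \<open>2 * l / q\<close>, each \<open>k\<close> can spoil at most one, since two
  spoiled values of \<open>A k + \<gamma> * Q k\<close> would be less than \<open>2 * l\<close> apart.
\<close>

lemma avoid_discs:
  fixes Q A :: "'k \<Rightarrow> complex"
  assumes I: "finite I" and q: "q > 0" "\<And>k. k \<in> I \<Longrightarrow> q \<le> cmod (Q k)" and l: "l \<ge> 0"
  obtains \<gamma> :: real where "0 \<le> \<gamma>" "\<gamma> \<le> 2 * real (card I) * l / q"
    "\<And>k. k \<in> I \<Longrightarrow> l \<le> cmod (A k + \<gamma> * Q k)"
proof (rule ccontr)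
  assume *: "\<not> thesis"
  define g where "g m = 2 * real m * l / q" for m :: nat
  have "\<exists>k. m \<le> card I \<longrightarrow> k \<in> I \<and> cmod (A k + g m * Q k) < l" for m
  proof (cases "m \<le> card I")
    case True
    then have "0 \<le> g m" "g m \<le> 2 * real (card I) * l / q"
      using q(1) l by (auto simp: g_def intro!: divide_right_mono mult_right_mono)
    then show ?thesis using * that[of "g m"] by (meson not_le)
  qed simp
  then obtain k where k: "\<And>m. m \<le> card I \<Longrightarrow> k m \<in> I \<and> cmod (A (k m) + g m * Q (k m)) < l"
    by metis
  have "\<not> inj_on k {..card I}"
  proof
    assume "inj_on k {..card I}"
    then have "card {..card I} \<le> card I" using k by (intro card_inj_on_le[OF _ _ I]) auto
    then show False by simp
  qed
  then obtain m m' where m: "m \<le> card I" "m' \<le> card I" "k m = k m'" "m < m'"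
    unfolding inj_on_def by (metis atMost_iff linorder_neqE_nat)
  have "cmod ((g m' - g m) * Q (k m)) < l + l"
  proof -
    have "complex_of_real (g m' - g m) * Q (k m) = (A (k m) + g m' * Q (k m)) - (A (k m) + g m * Q (k m))"
      by (simp add: algebra_simps)
    also have "cmod \<dots> \<le> cmod (A (k m) + g m' * Q (k m)) + cmod (A (k m) + g m * Q (k m))"
      by (rule norm_triangle_ineq4)
    also have "\<dots> < l + l" using k[OF m(1)] k[OF m(2)] m(3) by (intro add_strict_mono) auto
    finally show ?thesis .
  qed
  moreover have "2 * l \<le> cmod ((g m' - g m) * Q (k m))"
  proof -
    have "2 * l / q \<le> g m' - g m"
      using mult_right_mono[of 1 "real m' - real m" "2 * l / q"] m(4) q(1) l
      by (simp add: g_def algebra_simps diff_divide_distrib)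
    moreover from this have "0 \<le> g m' - g m" using q(1) l by (smt (verit) divide_nonneg_pos)
    ultimately have "2 * l / q * q \<le> (g m' - g m) * cmod (Q (k m))"
      using q k[OF m(1)] l by (intro mult_mono) auto
    also have "\<dots> \<le> cmod ((g m' - g m) * Q (k m))"
      unfolding norm_mult by (intro mult_right_mono) (auto simp del: of_real_diff)
    finally show ?thesis using q(1) by simp
  qed
  ultimately show False by simp
qed

text \<open>
  The requirement at \<open>j\<close> involves only \<open>\<gamma> 1, \<dots>, \<gamma> j\<close>, and the last of these with a coefficient that
  is not small, so the \<open>\<gamma> j\<close> can be chosen in turn.
\<close>

lemma avoid_discs_triangular:
  fixes a :: "'k \<Rightarrow> nat \<Rightarrow> nat \<Rightarrow> complex" and l :: "nat \<Rightarrow> real"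
  assumes I: "finite I" and q: "q > 0" "\<And>k j. k \<in> I \<Longrightarrow> j \<in> {1..n} \<Longrightarrow> q \<le> cmod (a k j j)"
    and l: "\<And>j. l j \<ge> 0"
  shows "\<exists>\<gamma> :: nat \<Rightarrow> real. \<forall>j\<in>{1..n}. 0 \<le> \<gamma> j \<and> \<gamma> j \<le> 2 * real (card I) * l j / q \<and>
      (\<forall>k\<in>I. l j \<le> cmod (b k j + (\<Sum>i\<in>{1..j}. \<gamma> i * a k j i)))"
  using q(2)
proof (induction n)
  case (Suc n)
  then obtain \<gamma> :: "nat \<Rightarrow> real" where \<gamma>: "\<And>j. j \<in> {1..n} \<Longrightarrow> 0 \<le> \<gamma> j \<and> \<gamma> j \<le> 2 * real (card I) * l j / q \<and>
      (\<forall>k\<in>I. l j \<le> cmod (b k j + (\<Sum>i\<in>{1..j}. \<gamma> i * a k j i)))"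
    by fastforce
  obtain c :: real where c: "0 \<le> c" "c \<le> 2 * real (card I) * l (Suc n) / q"
    "\<And>k. k \<in> I \<Longrightarrow> l (Suc n) \<le> cmod (b k (Suc n) + (\<Sum>i\<in>{1..n}. \<gamma> i * a k (Suc n) i) + c * a k (Suc n) (Suc n))"
    using avoid_discs[OF I q(1), of "\<lambda>k. a k (Suc n) (Suc n)" "l (Suc n)"
        "\<lambda>k. b k (Suc n) + (\<Sum>i\<in>{1..n}. \<gamma> i * a k (Suc n) i)"] Suc.prems l by auto
  define \<gamma>' where "\<gamma>' = \<gamma>(Suc n := c)"
  have same: "(\<Sum>i\<in>{1..j}. complex_of_real (\<gamma>' i) * a k j' i) = (\<Sum>i\<in>{1..j}. \<gamma> i * a k j' i)" if "j \<le> n" for j j' k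
    using that by (intro sum.cong) (auto simp: \<gamma>'_def)
  show ?case
  proof (intro exI[of _ \<gamma>'] ballI)
    fix j assume j: "j \<in> {1..Suc n}"
    show "0 \<le> \<gamma>' j \<and> \<gamma>' j \<le> 2 * real (card I) * l j / q \<and>
      (\<forall>k\<in>I. l j \<le> cmod (b k j + (\<Sum>i\<in>{1..j}. \<gamma>' i * a k j i)))"
    proof (cases "j = Suc n")
      case True
      have "(\<Sum>i\<in>{1..Suc n}. complex_of_real (\<gamma>' i) * a k (Suc n) i) =
          (\<Sum>i\<in>{1..n}. \<gamma> i * a k (Suc n) i) + c * a k (Suc n) (Suc n)" for k
        using same[of n k "Suc n"] by (simp add: \<gamma>'_def)
      then show ?thesis using True c by (simp add: \<gamma>'_def add.assoc)
    next
      case False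
      then have "j \<in> {1..n}" "j \<le> n" using j by auto
      then show ?thesis using \<gamma>[of j] same[of j] by (simp add: \<gamma>'_def)
    qed
  qed
qed simp

section \<open>The inductive step\<close>

lemma cmod_add_or_diff_ge:
  assumes "t \<ge> 0"
  shows "\<exists>s\<in>{1, - 1 :: real}. t \<le> cmod (z + complex_of_real (s * t))"
proof (rule ccontr)
  assume "\<not> ?thesis"
  then have "cmod (z + t) < t" "cmod (z - t) < t" by auto
  moreover have "2 * t = cmod ((z + t) - (z - t))" using assms by simp
  ultimately show False using norm_triangle_ineq4[of "z + t" "z - t"] by linarith
qed

text \<open>
  The two-sided bound for the entry at positions \<open>j < n\<close>. The constant \<open>1 / 1600\<close> is
  \<open>1 / 8 * (1 / 40) * (1 / 5)\<close>: couplings to reservoir vectors are at least \<open>\<delta> / 5\<close>, avoiding four discs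
  costs a factor \<open>8\<close>, and coefficients up to \<open>1 / 40 * sqrt j / (n * sqrt n)\<close> keep the new part
  short enough.
\<close>

definition balanced_entry :: "real \<Rightarrow> nat \<Rightarrow> nat \<Rightarrow> complex \<Rightarrow> bool" where
  "balanced_entry \<delta> j n z \<longleftrightarrow>
    \<delta> / 1600 * sqrt (real j) / (real n * sqrt (real n)) \<le> cmod z \<and> cmod z \<le> \<delta> / sqrt (real n)"

text \<open>
  The properties of the shifted operator \<open>S = T - \<alpha>\<close> on which the construction rests. The bound
  \<open>K\<close> may be huge compared with \<open>\<delta>\<close>; it only meets the components of size \<open>\<epsilon>\<close> that are added for
  completeness and may leave the complement of \<open>F\<close>, so that \<open>K * \<epsilon>\<close> is what counts. The diagonal
  is measured for \<open>T\<close>, whence the \<open>\<alpha>\<close> in the last condition.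
\<close>

locale essentially_small =
  fixes S :: "'a::complex_hilbert \<Rightarrow> 'a" and \<alpha> :: complex and \<delta> K \<epsilon> :: real and F :: "'a set"
  assumes S: "bounded_clinear S"
    and \<delta>: "\<delta> > 0"
    and K: "K > 0" "norm (S x) \<le> K * norm x"
    and \<epsilon>: "\<epsilon> > 0" "\<epsilon> \<le> 1 / 40" "K * \<epsilon> \<le> \<delta> / 400"
    and F: "finite F"
    and small: "x \<in> perp F \<Longrightarrow> y \<in> perp F \<Longrightarrow> cmod (cinner (S x) y) \<le> 4 * \<delta> * norm x * norm y"
    and fresh: "finite G \<Longrightarrow> \<exists>v t. norm v = 1 \<and> norm t = 1 \<and> cinner v t = 0 \<and>
      (\<forall>y\<in>G. cinner v y = 0 \<and> cinner v (S y) = 0 \<and> cinner (S v) y = 0) \<and>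
      (\<forall>y\<in>G. cinner t y = 0 \<and> cinner t (S y) = 0 \<and> cinner (S t) y = 0) \<and>
      cinner (S t) v = cinner (S v) t \<and> 23 * \<delta> / 100 \<le> cmod (cinner (S v) t) \<and>
      6 * \<delta> / 100 \<le> cmod (\<alpha> + cinner (S v) v)"
begin

text \<open>
  The state after \<open>n\<close> steps: the basis vectors \<open>u j\<close> and the reservoir vectors \<open>p j\<close>, orthogonal to
  all of them. The fourth and fifth conditions make the matrix of couplings between \<open>u\<close> and \<open>p\<close>
  triangular with a diagonal bounded below. The \<open>p j\<close> do not stay orthonormal; the sixth condition
  controls the loss. The last one remembers that each \<open>u j\<close> is essentially orthogonal to \<open>F\<close>.
\<close>

definition admissible :: "nat \<Rightarrow> (nat \<Rightarrow> 'a) \<Rightarrow> (nat \<Rightarrow> 'a) \<Rightarrow> bool" where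
  "admissible n u p \<longleftrightarrow>
    (\<forall>i\<in>{1..n}. \<forall>j\<in>{1..n}. cinner (u i) (u j) = (if i = j then 1 else 0)) \<and>
    (\<forall>i\<in>{1..n}. \<forall>j\<in>{1..n}. cinner (p j) (u i) = 0) \<and>
    (\<forall>j\<in>{1..n}. p j \<in> perp F) \<and>
    (\<forall>j\<in>{1..n}. \<forall>i\<in>{1..<j}. cinner (S (u i)) (p j) = 0 \<and> cinner (S (p j)) (u i) = 0) \<and>
    (\<forall>j\<in>{1..n}. \<delta> / 5 \<le> cmod (cinner (S (u j)) (p j)) \<and> \<delta> / 5 \<le> cmod (cinner (S (p j)) (u j))) \<and>
    (\<forall>c :: nat \<Rightarrow> real. (norm (\<Sum>j\<in>{1..n}. c j *\<^sub>R p j))\<^sup>2 \<le>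
      (\<Sum>j\<in>{1..n}. real (n + 1) / real (j + 1) * (c j)\<^sup>2)) \<and>
    (\<forall>j\<in>{1..n}. \<forall>w\<in>perp F. cmod (cinner (S (u j)) w) \<le> 8 * \<delta> * norm w \<and>
      cmod (cinner (S w) (u j)) \<le> 8 * \<delta> * norm w)"

lemma cinner_S_le: "cmod (cinner (S x) y) \<le> K * norm x * norm y"
  using cinner_Cauchy_Schwarz[of "S x" y] mult_right_mono[OF K(2)[of x], of "norm y"] by simp

text \<open>
  Here the exponents of the theorem are born: coefficients of size \<open>sqrt j / (N * sqrt N)\<close> have squares
  \<open>j / N ^ 3\<close>, and the growth factor \<open>N / (j + 1)\<close> cancels the \<open>j\<close>, so that about \<open>N\<close> terms of size
  \<open>1 / N\<^sup>2\<close> remain.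
\<close>

lemma reservoir_weights:
  assumes "\<And>j. j \<in> {1..n} \<Longrightarrow> 0 \<le> c j \<and> c j \<le> a * sqrt (real j) / (real (Suc n) * sqrt (real (Suc n)))"
  shows "(\<Sum>j\<in>{1..n}. real (n + 1) / real (j + 1) * (c j)\<^sup>2) \<le> a\<^sup>2 / real (Suc n)"
proof -
  define N where "N = real (Suc n)"
  have N: "N > 0" by (simp add: N_def)
  have "(\<Sum>j\<in>{1..n}. real (n + 1) / real (j + 1) * (c j)\<^sup>2) \<le> (\<Sum>j\<in>{1..n}. a\<^sup>2 / N\<^sup>2)"
  proof (rule sum_mono)
    fix j assume j: "j \<in> {1..n}"
    have "(c j)\<^sup>2 \<le> (a * sqrt (real j) / (N * sqrt N))\<^sup>2"
      using assms[OF j] by (intro power_mono) (auto simp: N_def)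
    also have "\<dots> = a\<^sup>2 * real j / (N\<^sup>2 * N)"
      using N by (simp add: power_divide power_mult_distrib)
    finally have "N / real (j + 1) * (c j)\<^sup>2 \<le> N / real (j + 1) * (a\<^sup>2 * real j / (N\<^sup>2 * N))"
      using N by (intro mult_left_mono) auto
    also have "\<dots> = a\<^sup>2 / N\<^sup>2 * (real j / real (j + 1))"
    proof -
      have "N / M * (A * t / (P * N)) = A / P * (t / M)" if "M > 0" "P > 0" for M A t P :: real
        using that N by (simp add: field_simps)
      then show ?thesis using N by simp
    qed
    also have "\<dots> \<le> a\<^sup>2 / N\<^sup>2 * 1" by (intro mult_left_mono) auto
    finally show "real (n + 1) / real (j + 1) * (c j)\<^sup>2 \<le> a\<^sup>2 / N\<^sup>2" by (simp add: N_def)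
  qed
  also have "\<dots> = a\<^sup>2 / N\<^sup>2 * real n" by simp
  also have "\<dots> \<le> a\<^sup>2 / N\<^sup>2 * N" by (intro mult_left_mono) (auto simp: N_def)
  also have "\<dots> = a\<^sup>2 / N" using N by (simp add: power2_eq_square)
  finally show ?thesis by (simp add: N_def)
qed

text \<open>
  The part of the next basis vector that lies in the old space. The coefficients of \<open>y\<close> are chosen
  so that the lower bounds hold for both signs of \<open>h\<close>; the sign is chosen afterwards, so that \<open>y\<close>
  does not cancel the component of \<open>h \<rho>\<close> along the residual. Choosing in the other order
  would be circular, since \<open>y\<close> depends on \<open>h \<rho>\<close>.
\<close>

lemma choose_old_part:
  assumes adm: "admissible n u p"
  defines "N \<equiv> real (Suc n)" and "B \<equiv> u ` {1..n}"
  shows "\<exists>y h. y \<in> perp F \<and> y \<in> perp B \<and> norm y \<le> 1 / 40 / sqrt N \<and>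
    \<bar>h\<bar> = \<epsilon> / sqrt N \<and>
    (\<forall>j\<in>{1..n}. \<delta> / 1600 * sqrt (real j) / (N * sqrt N) \<le> cmod (cinner (S (y + h *\<^sub>R sgn (g - proj B g))) (u j)) \<and>
      \<delta> / 1600 * sqrt (real j) / (N * sqrt N) \<le> cmod (cinner (S (u j)) (y + h *\<^sub>R sgn (g - proj B g)))) \<and>
    \<epsilon> / sqrt N * norm (g - proj B g) \<le> cmod (cinner (g - proj B g) (y + h *\<^sub>R sgn (g - proj B g)))"
proof -
  have N: "N \<ge> 1" by (simp add: N_def)
  define \<rho> where "\<rho> = sgn (g - proj B g)"
  define h0 where "h0 = \<epsilon> / sqrt N"
  have h0: "h0 > 0" using \<epsilon>(1) N by (simp add: h0_def)
  define l where "l j = \<delta> / 1600 * sqrt (real j) / (N * sqrt N)" for j :: nat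
  have l: "l j \<ge> 0" for j using \<delta> N by (simp add: l_def)
  define sg where "sg s = (if s then 1 else - 1 :: real)" for s
  \<comment> \<open>four discs for each \<open>j\<close>: one for each sign, and one each for \<open>S\<close> and its adjoint\<close>
  define a where "a = (\<lambda>(side :: bool, s :: bool) j i. if side then cinner (S (p i)) (u j) else cinner (S (u j)) (p i))"
  define b where "b = (\<lambda>(side, s) j. complex_of_real (sg s * h0) *
    (if side then cinner (S \<rho>) (u j) else cinner (S (u j)) \<rho>))"
  have weight: "2 * real (card (UNIV :: (bool \<times> bool) set)) * l j / (\<delta> / 5) = 40 * l j / \<delta>" for j
    by simp
  have "\<exists>\<gamma> :: nat \<Rightarrow> real. \<forall>j\<in>{1..n}. 0 \<le> \<gamma> j \<and> \<gamma> j \<le> 2 * real (card (UNIV :: (bool \<times> bool) set)) * l j / (\<delta> / 5) \<and>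
      (\<forall>k\<in>UNIV. l j \<le> cmod (b k j + (\<Sum>i\<in>{1..j}. \<gamma> i * a k j i)))"
    using adm \<delta> l by (intro avoid_discs_triangular) (auto simp: admissible_def a_def)
  then obtain \<gamma> :: "nat \<Rightarrow> real" where "\<forall>j\<in>{1..n}. 0 \<le> \<gamma> j \<and> \<gamma> j \<le> 40 * l j / \<delta> \<and>
      (\<forall>k\<in>UNIV. l j \<le> cmod (b k j + (\<Sum>i\<in>{1..j}. \<gamma> i * a k j i)))"
    unfolding weight by blast
  then have \<gamma>: "\<And>j. j \<in> {1..n} \<Longrightarrow> 0 \<le> \<gamma> j \<and> \<gamma> j \<le> 40 * l j / \<delta>"
    "\<And>j k. j \<in> {1..n} \<Longrightarrow> l j \<le> cmod (b k j + (\<Sum>i\<in>{1..j}. \<gamma> i * a k j i))"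
    by blast+
  define y where "y = (\<Sum>j\<in>{1..n}. \<gamma> j *\<^sub>R p j)"
  have yF: "y \<in> perp F" unfolding y_def
    using adm by (intro perp_sum perp_scaleR) (auto simp: admissible_def)
  have yB: "y \<in> perp B" unfolding y_def
    using adm by (intro perp_sum perp_scaleR) (auto simp: admissible_def B_def perp_def)
  have "(norm y)\<^sup>2 \<le> (\<Sum>j\<in>{1..n}. real (n + 1) / real (j + 1) * (\<gamma> j)\<^sup>2)"
    using adm by (auto simp: admissible_def y_def)
  also have "\<dots> \<le> (1 / 40)\<^sup>2 / real (Suc n)"
  proof (rule reservoir_weights)
    fix j assume "j \<in> {1..n}"
    then show "0 \<le> \<gamma> j \<and> \<gamma> j \<le> 1 / 40 * sqrt (real j) / (real (Suc n) * sqrt (real (Suc n)))"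
      using \<gamma>(1)[of j] \<delta> by (simp add: l_def N_def)
  qed
  also have "\<dots> = (1 / 40 / sqrt N)\<^sup>2" by (simp add: N_def power_divide)
  finally have y: "norm y \<le> 1 / 40 / sqrt N" using N by (intro power2_le_imp_le[of "norm y"]) auto
  have Sy: "cinner (S y) (u j) = (\<Sum>i\<in>{1..j}. \<gamma> i * cinner (S (p i)) (u j))"
    "cinner (S (u j)) y = (\<Sum>i\<in>{1..j}. \<gamma> i * cinner (S (u j)) (p i))" if j: "j \<in> {1..n}" for j
  proof -
    have zero: "cinner (S (p i)) (u j) = 0" "cinner (S (u j)) (p i) = 0" if "i \<in> {1..n} - {1..j}" for i
      using adm that j unfolding admissible_def by auto
    have "cinner (S y) (u j) = (\<Sum>i\<in>{1..n}. \<gamma> i * cinner (S (p i)) (u j))"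
      by (simp add: y_def bounded_clinear_sum[OF S] bounded_clinear_scaleR[OF S] cinner_sum_left cinner_simps)
    then show "cinner (S y) (u j) = (\<Sum>i\<in>{1..j}. \<gamma> i * cinner (S (p i)) (u j))"
      using zero j by (simp only:) (intro sum.mono_neutral_right, auto)
    have "cinner (S (u j)) y = (\<Sum>i\<in>{1..n}. \<gamma> i * cinner (S (u j)) (p i))"
      by (simp add: y_def cinner_sum_right cinner_simps)
    then show "cinner (S (u j)) y = (\<Sum>i\<in>{1..j}. \<gamma> i * cinner (S (u j)) (p i))"
      using zero j by (simp only:) (intro sum.mono_neutral_right, auto)
  qed
  define r where "r = g - proj B g"
  have "0 \<le> h0 * norm r" using h0 by simp
  then obtain s where s: "s \<in> {1, - 1 :: real}"
    "h0 * norm r \<le> cmod (cinner r y + complex_of_real (s * (h0 * norm r)))"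
    using cmod_add_or_diff_ge by metis
  have rr: "cinner r \<rho> = norm r"
    by (cases "r = 0") (simp_all add: \<rho>_def flip: r_def, simp add: sgn_div_norm cinner_simps cinner_self power2_eq_square)
  define x where "x = y + (s * h0) *\<^sub>R \<rho>"
  have "s = sg True \<or> s = sg False" using s(1) by (auto simp: sg_def)
  then obtain \<sigma> where \<sigma>: "s = sg \<sigma>" by blast
  have "l j \<le> cmod (cinner (S x) (u j)) \<and> l j \<le> cmod (cinner (S (u j)) x)" if j: "j \<in> {1..n}" for j
    using \<gamma>(2)[OF j, of "(True, \<sigma>)"] \<gamma>(2)[OF j, of "(False, \<sigma>)"]
    by (simp add: x_def \<sigma> bounded_clinear_simps[OF S] cinner_simps Sy[OF j] a_def b_def add.commute)
  moreover have "h0 * norm r \<le> cmod (cinner r x)"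
    using s(2) by (simp add: x_def cinner_simps rr mult.assoc)
  moreover have "\<bar>s * h0\<bar> = h0" using s(1) h0 by auto
  ultimately show ?thesis
    using yF yB y unfolding x_def l_def r_def \<rho>_def h0_def
    by (intro exI[of _ y] exI[of _ "s * h0"]) (auto simp: h0_def)
qed

end

context essentially_small
begin

text \<open>
  The reservoir vectors are made orthogonal to the new vector \<open>w = s *\<^sub>R v + x\<close> by adding multiples
  of \<open>v\<close>, not by projecting along \<open>w\<close>. As \<open>v\<close> is not coupled to any earlier \<open>u j\<close>, all couplings
  in \<open>admissible\<close> survive unchanged. The added multiples of \<open>v\<close> come from the numbers
  \<open>cinner (p j) x\<close>, and since \<open>norm x\<close> is at most \<open>1 / (20 * sqrt N)\<close>, the squared norm of any
  combination of the \<open>p j\<close> grows at most by the factor \<open>1 + 1 / N\<close>.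
\<close>

lemma extend_admissible:
  fixes g :: 'a
  assumes adm: "admissible n u p"
  defines "N \<equiv> real (Suc n)" and "r \<equiv> g - proj (u ` {1..n}) g"
  shows "\<exists>w p'. admissible (Suc n) (u(Suc n := w)) p' \<and>
    \<delta> / 25 \<le> cmod (\<alpha> + cinner (S w) w) \<and>
    (\<forall>j\<in>{1..n}. balanced_entry \<delta> j (Suc n) (cinner (S w) (u j)) \<and>
      balanced_entry \<delta> j (Suc n) (cinner (S (u j)) w)) \<and>
    \<epsilon> / sqrt N * norm r \<le> cmod (cinner r w)"
proof -
  have N: "N \<ge> 1" by (simp add: N_def)
  note a = adm[unfolded admissible_def]
  have uu: "cinner (u i) (u j) = (if i = j then 1 else 0)" if "i \<in> {1..n}" "j \<in> {1..n}" for i j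
    using a that by blast
  have pu: "cinner (p j) (u i) = 0" if "i \<in> {1..n}" "j \<in> {1..n}" for i j using a that by blast
  have pF: "p j \<in> perp F" if "j \<in> {1..n}" for j using a that by blast
  have Supz: "cinner (S (u i)) (p j) = 0" "cinner (S (p j)) (u i) = 0" if "j \<in> {1..n}" "i \<in> {1..<j}" for i j
    using a that by blast+
  have Sup: "\<delta> / 5 \<le> cmod (cinner (S (u j)) (p j))" "\<delta> / 5 \<le> cmod (cinner (S (p j)) (u j))" if "j \<in> {1..n}" for j
    using a that by blast+
  have growth: "(norm (\<Sum>j\<in>{1..n}. c j *\<^sub>R p j))\<^sup>2 \<le> (\<Sum>j\<in>{1..n}. real (n + 1) / real (j + 1) * (c j)\<^sup>2)"
    for c :: "nat \<Rightarrow> real" using a by blast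
  have uF: "cmod (cinner (S (u j)) f) \<le> 8 * \<delta> * norm f" "cmod (cinner (S f) (u j)) \<le> 8 * \<delta> * norm f"
    if "j \<in> {1..n}" "f \<in> perp F" for j f using a that by blast+

  define \<rho> where "\<rho> = sgn r"
  obtain y h where y: "y \<in> perp F" "y \<in> perp (u ` {1..n})" "norm y \<le> 1 / 40 / sqrt N" and h: "\<bar>h\<bar> = \<epsilon> / sqrt N"
    and low: "\<And>j. j \<in> {1..n} \<Longrightarrow> \<delta> / 1600 * sqrt (real j) / (N * sqrt N) \<le> cmod (cinner (S (y + h *\<^sub>R \<rho>)) (u j)) \<and>
      \<delta> / 1600 * sqrt (real j) / (N * sqrt N) \<le> cmod (cinner (S (u j)) (y + h *\<^sub>R \<rho>))"
    and drain: "\<epsilon> / sqrt N * norm r \<le> cmod (cinner r (y + h *\<^sub>R \<rho>))"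
    using choose_old_part[OF adm, of g] unfolding r_def N_def \<rho>_def by blast
  define x where "x = y + h *\<^sub>R \<rho>"
  have ons: "orthonormal_set (u ` {1..n})"
    using uu unfolding orthonormal_set_def by fastforce
  have rB: "r \<in> perp (u ` {1..n})" unfolding r_def by (rule diff_proj_perp[OF ons])
  have xB: "x \<in> perp (u ` {1..n})"
    unfolding x_def \<rho>_def sgn_div_norm by (intro perp_add perp_scaleR y rB)
  then have xu: "cinner x (u i) = 0" if "i \<in> {1..n}" for i using that by (auto simp: perp_def)
  then have ux: "cinner (u i) x = 0" if "i \<in> {1..n}" for i using that cinner_eq_zero_commute by blast
  have \<rho>1: "norm \<rho> \<le> 1" by (simp add: \<rho>_def norm_sgn)
  have sqN: "sqrt N \<ge> 1" using N by simp
  have hK: "\<bar>h\<bar> * K \<le> \<delta> / 400 / sqrt N" "\<bar>h\<bar> * K \<le> \<delta> / 400"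
  proof -
    have "\<bar>h\<bar> * K = (K * \<epsilon>) / sqrt N" by (simp add: h)
    also have "\<dots> \<le> \<delta> / 400 / sqrt N" using \<epsilon>(3) sqN by (intro divide_right_mono) auto
    finally show "\<bar>h\<bar> * K \<le> \<delta> / 400 / sqrt N" .
    also have "\<dots> \<le> \<delta> / 400 / 1" using sqN \<delta> by (intro divide_left_mono) auto
    finally show "\<bar>h\<bar> * K \<le> \<delta> / 400" by simp
  qed
  have h40: "\<bar>h\<bar> \<le> 1 / 40 / sqrt N" unfolding h using \<epsilon>(2) sqN by (intro divide_right_mono) auto
  have le40: "1 / 40 / sqrt N \<le> 1 / 40" using sqN by (simp add: field_simps)
  have h\<rho>: "norm (h *\<^sub>R \<rho>) \<le> \<bar>h\<bar>" using \<rho>1 by (simp add: mult_left_le)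
  have x_le: "norm x \<le> 1 / 20 / sqrt N"
    using norm_triangle_ineq[of y "h *\<^sub>R \<rho>"] y(3) h40 h\<rho> unfolding x_def by argo
  have xN: "(norm x)\<^sup>2 \<le> 1 / 400 / N"
    using power_mono[OF x_le, of 2] N by (simp add: power_divide)
  have x400: "(norm x)\<^sup>2 \<le> 1 / 400"
  proof -
    have "1 / 400 / N \<le> 1 / 400" using N by (simp add: field_simps)
    then show ?thesis using xN by simp
  qed
  have S\<rho>: "cmod (cinner (S z) (h *\<^sub>R \<rho>)) \<le> \<bar>h\<bar> * K * norm z" "cmod (cinner (S (h *\<^sub>R \<rho>)) z) \<le> \<bar>h\<bar> * K * norm z" for z
  proof -
    have "cmod (cinner (S z) (h *\<^sub>R \<rho>)) \<le> K * norm z * norm (h *\<^sub>R \<rho>)" by (rule cinner_S_le)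
    also have "\<dots> \<le> K * norm z * \<bar>h\<bar>" using h\<rho> K(1) by (intro mult_left_mono) auto
    finally show "cmod (cinner (S z) (h *\<^sub>R \<rho>)) \<le> \<bar>h\<bar> * K * norm z" by (simp add: mult_ac)
    have "cmod (cinner (S (h *\<^sub>R \<rho>)) z) \<le> K * norm (h *\<^sub>R \<rho>) * norm z" by (rule cinner_S_le)
    also have "\<dots> \<le> K * \<bar>h\<bar> * norm z" using h\<rho> K(1) by (intro mult_left_mono mult_right_mono) auto
    finally show "cmod (cinner (S (h *\<^sub>R \<rho>)) z) \<le> \<bar>h\<bar> * K * norm z" by (simp add: mult_ac)
  qed
  have u1: "norm (u j) = 1" if "j \<in> {1..n}" for j using uu[OF that that] by (simp add: norm_eq_1_cinner)
  \<comment> \<open>\<open>y\<close> is orthogonal to \<open>F\<close> and sees the bound \<open>8 * \<delta>\<close>; \<open>h \<rho>\<close> sees \<open>K\<close>, tamed by \<open>hK\<close>\<close>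
  have up: "cmod (cinner (S x) (u j)) \<le> \<delta> / sqrt N \<and> cmod (cinner (S (u j)) x) \<le> \<delta> / sqrt N" if j: "j \<in> {1..n}" for j
  proof -
    have "8 * \<delta> * norm y \<le> 8 * \<delta> * (1 / 40 / sqrt N)" using y(3) \<delta> by (intro mult_left_mono) auto
    also have "\<dots> = (1 / 5) * (\<delta> / sqrt N)" by simp
    finally have "8 * \<delta> * norm y \<le> (1 / 5) * (\<delta> / sqrt N)" .
    moreover have "\<bar>h\<bar> * K * norm (u j) \<le> (1 / 400) * (\<delta> / sqrt N)" using hK(1) u1[OF j] by simp
    moreover have "\<delta> / sqrt N \<ge> 0" using \<delta> sqN by simp
    moreover have "cmod (cinner (S x) (u j)) \<le> cmod (cinner (S y) (u j)) + cmod (cinner (S (h *\<^sub>R \<rho>)) (u j))"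
      unfolding x_def bounded_clinear_add[OF S] cinner_add_left by (rule norm_triangle_ineq)
    moreover have "cmod (cinner (S (u j)) x) \<le> cmod (cinner (S (u j)) y) + cmod (cinner (S (u j)) (h *\<^sub>R \<rho>))"
      unfolding x_def cinner_add_right by (rule norm_triangle_ineq)
    ultimately show ?thesis
      using uF[OF j y(1)] S\<rho>[of "u j"] by argo
  qed

  define G where "G = F \<union> u ` {1..n} \<union> p ` {1..n} \<union> {x, r}"
  have "finite G" using F by (simp add: G_def)
  then obtain v t where v: "norm v = 1" "\<And>z. z \<in> G \<Longrightarrow> cinner v z = 0 \<and> cinner v (S z) = 0 \<and> cinner (S v) z = 0"
    and t: "norm t = 1" "\<And>z. z \<in> G \<Longrightarrow> cinner t z = 0 \<and> cinner t (S z) = 0 \<and> cinner (S t) z = 0"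
    and vt: "cinner v t = 0" "cinner (S t) v = cinner (S v) t" "23 * \<delta> / 100 \<le> cmod (cinner (S v) t)"
    and diag: "6 * \<delta> / 100 \<le> cmod (\<alpha> + cinner (S v) v)"
    using fresh[of G] by blast
  have v': "cinner z v = 0" "cinner (S z) v = 0" and t': "cinner z t = 0" "cinner (S z) t = 0" if "z \<in> G" for z
    using v(2)[OF that] t(2)[OF that] cinner_eq_zero_commute by blast+
  have rG: "r \<in> G" by (simp add: G_def)
  have inG: "x \<in> G" "\<And>j. j \<in> {1..n} \<Longrightarrow> u j \<in> G" "\<And>j. j \<in> {1..n} \<Longrightarrow> p j \<in> G" "\<And>f. f \<in> F \<Longrightarrow> f \<in> G"
    by (auto simp: G_def)
  have tv: "cinner t v = 0" using vt(1) cinner_eq_zero_commute by blast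
  have vF: "v \<in> perp F" and tF: "t \<in> perp F" using v(2) t(2) inG(4) by (auto simp: perp_def)
  have vv: "cinner v v = 1" and tt: "cinner t t = 1" using v(1) t(1) by (simp_all add: norm_eq_1_cinner)

  define s where "s = sqrt (1 - (norm x)\<^sup>2)"
  have s2: "s\<^sup>2 = 1 - (norm x)\<^sup>2" using x400 by (simp add: s_def)
  have s: "s > 0" "s \<ge> 9 / 10"
  proof -
    show "s \<ge> 9 / 10" unfolding s_def using x400 by (intro real_le_rsqrt) (simp add: power2_eq_square)
    then show "s > 0" by simp
  qed
  define w where "w = s *\<^sub>R v + x"
  have Sw: "S w = s *\<^sub>R S v + S x" by (simp add: w_def bounded_clinear_simps[OF S])
  have ww: "cinner w w = 1"
  proof -
    have "(norm w)\<^sup>2 = (norm (s *\<^sub>R v))\<^sup>2 + (norm x)\<^sup>2"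
      unfolding w_def using v(2)[OF inG(1)] by (intro pythagoras) (simp add: cinner_simps)
    also have "\<dots> = 1" using s2 v(1) by (simp add: power_mult_distrib)
    finally show ?thesis by (simp only: cinner_self of_real_1)
  qed
  have w1: "norm w = 1" using ww by (simp add: norm_eq_1_cinner)
  define \<kappa> where "\<kappa> z = - cinner z x / s" for z
  define p' where "p' j = (if j = Suc n then t else p j + \<kappa> (p j) *\<^sub>C v)" for j
  have p'_old: "p' j = p j + \<kappa> (p j) *\<^sub>C v" if "j \<in> {1..n}" for j using that by (simp add: p'_def)
  have Sp'_old: "S (p' j) = S (p j) + \<kappa> (p j) *\<^sub>C S v" if "j \<in> {1..n}" for j
    using p'_old[OF that] by (simp add: bounded_clinear_simps[OF S])
  define u' where "u' = u(Suc n := w)"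
  have u'_old: "u' j = u j" if "j \<in> {1..n}" for j using that by (simp add: u'_def)
  have u'_new: "u' (Suc n) = w" and p'_new: "p' (Suc n) = t" by (simp_all add: u'_def p'_def)
  have wu: "cinner w (u j) = 0" "cinner (u j) w = 0" if "j \<in> {1..n}" for j
    using v(2)[OF inG(2)[OF that]] v'[OF inG(2)[OF that]] xu[OF that] ux[OF that]
    by (simp_all add: w_def cinner_simps)
  have split: "j \<in> {1..n} \<or> j = Suc n" if "j \<in> {1..Suc n}" for j using that by auto

  have "admissible (Suc n) u' p'"
    unfolding admissible_def
  proof (intro conjI ballI allI)
    fix i j assume "i \<in> {1..Suc n}" "j \<in> {1..Suc n}"
    from split[OF this(1)] split[OF this(2)]
    show "cinner (u' i) (u' j) = (if i = j then 1 else 0)"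
      by (elim disjE) (auto simp: u'_old u'_new uu wu ww)
  next
    fix i j assume "i \<in> {1..Suc n}" "j \<in> {1..Suc n}"
    from split[OF this(1)] split[OF this(2)]
    show "cinner (p' j) (u' i) = 0"
    proof (elim disjE)
      assume ij: "i \<in> {1..n}" "j \<in> {1..n}"
      then show ?thesis using v(2)[OF inG(2)[OF ij(1)]]
        by (simp add: u'_old p'_old pu cinner_simps)
    next
      assume ij: "i \<in> {1..n}" "j = Suc n"
      then show ?thesis using t(2)[OF inG(2)[OF ij(1)]] by (simp add: u'_old p'_new)
    next
      assume ij: "i = Suc n" "j \<in> {1..n}"
      then show ?thesis
        using s(1) v'[OF inG(3)[OF ij(2)]] v(2)[OF inG(1)]
        by (simp add: u'_new p'_old w_def cinner_simps vv \<kappa>_def)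
    next
      assume ij: "i = Suc n" "j = Suc n"
      then show ?thesis using t(2)[OF inG(1)] by (simp add: u'_new p'_new w_def cinner_simps tv)
    qed
  next
    fix j assume "j \<in> {1..Suc n}"
    from split[OF this] show "p' j \<in> perp F"
      by (elim disjE) (auto simp: p'_old p'_new intro!: perp_add perp_scaleC pF vF tF)
  next
    fix j i assume j: "j \<in> {1..Suc n}" and "i \<in> {1..<j}"
    then have i: "i \<in> {1..n}" by auto
    from split[OF j] show "cinner (S (u' i)) (p' j) = 0"
      using Supz(1)[of j i] \<open>i \<in> {1..<j}\<close> v'[OF inG(2)[OF i]] t'[OF inG(2)[OF i]]
      by (elim disjE) (auto simp: u'_old[OF i] p'_old p'_new cinner_simps)
    from split[OF j] show "cinner (S (p' j)) (u' i) = 0"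
      using Supz(2)[of j i] \<open>i \<in> {1..<j}\<close> v(2)[OF inG(2)[OF i]] t(2)[OF inG(2)[OF i]]
      by (elim disjE) (auto simp: u'_old[OF i] Sp'_old p'_new cinner_simps)
  next
    have q: "\<delta> / 5 \<le> s * cmod (cinner (S v) t)"
    proof -
      have "\<delta> / 5 \<le> 9 / 10 * (23 * \<delta> / 100)" using \<delta> by simp
      also have "\<dots> \<le> s * cmod (cinner (S v) t)" using s vt(3) \<delta> by (intro mult_mono) auto
      finally show ?thesis .
    qed
    fix j assume j: "j \<in> {1..Suc n}"
    from split[OF j] show "\<delta> / 5 \<le> cmod (cinner (S (u' j)) (p' j))"
    proof
      assume j: "j \<in> {1..n}"
      then show ?thesis using Sup(1)[OF j] v'[OF inG(2)[OF j]]
        by (simp add: u'_old p'_old cinner_simps)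
    next
      assume j: "j = Suc n"
      then show ?thesis using q s t'[OF inG(1)]
        by (simp add: u'_new p'_new Sw cinner_simps norm_mult)
    qed
    from split[OF j] show "\<delta> / 5 \<le> cmod (cinner (S (p' j)) (u' j))"
    proof
      assume j: "j \<in> {1..n}"
      then show ?thesis using Sup(2)[OF j] v(2)[OF inG(2)[OF j]]
        by (simp add: u'_old Sp'_old cinner_simps)
    next
      assume j: "j = Suc n"
      then show ?thesis using q s t(2)[OF inG(1)] vt(2)
        by (simp add: u'_new p'_new w_def cinner_simps norm_mult)
    qed
  next
    fix c :: "nat \<Rightarrow> real"
    define z where "z = (\<Sum>j\<in>{1..n}. c j *\<^sub>R p j)"
    have zv: "cinner z v = 0" and zt: "cinner z t = 0"
      unfolding z_def cinner_sum_left using v'[OF inG(3)] t'[OF inG(3)] by (simp_all add: cinner_simps)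
    have "(\<Sum>j\<in>{1..n}. c j *\<^sub>R p' j) = z + \<kappa> z *\<^sub>C v"
    proof -
      have "(\<Sum>j\<in>{1..n}. c j *\<^sub>R p' j) = (\<Sum>j\<in>{1..n}. c j *\<^sub>R p j + (c j * \<kappa> (p j)) *\<^sub>C v)"
        by (intro sum.cong) (auto simp: p'_old scaleR_eq_scaleC scaleC_scaleC scaleC_add_right)
      also have "\<dots> = z + (\<Sum>j\<in>{1..n}. c j * \<kappa> (p j)) *\<^sub>C v"
        by (simp add: sum.distrib z_def complex_vector.scale_sum_left)
      also have "(\<Sum>j\<in>{1..n}. c j * \<kappa> (p j)) = \<kappa> z"
        by (simp add: \<kappa>_def z_def cinner_sum_left cinner_simps sum_divide_distrib sum_negf)
      finally show ?thesis .
    qed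
    then have sum: "(\<Sum>j\<in>{1..Suc n}. c j *\<^sub>R p' j) = (z + \<kappa> z *\<^sub>C v) + c (Suc n) *\<^sub>R t"
      by (simp add: p'_new)
    have "(norm (\<Sum>j\<in>{1..Suc n}. c j *\<^sub>R p' j))\<^sup>2 = (norm (z + \<kappa> z *\<^sub>C v))\<^sup>2 + (norm (c (Suc n) *\<^sub>R t))\<^sup>2"
      unfolding sum by (rule pythagoras) (simp add: cinner_simps zt vt(1))
    also have "(norm (z + \<kappa> z *\<^sub>C v))\<^sup>2 = (norm z)\<^sup>2 + (norm (\<kappa> z *\<^sub>C v))\<^sup>2"
      by (rule pythagoras) (simp add: cinner_simps zv)
    also have "(norm (\<kappa> z *\<^sub>C v))\<^sup>2 \<le> (norm z)\<^sup>2 / N"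
    proof -
      have "(norm (\<kappa> z *\<^sub>C v))\<^sup>2 = (cmod (cinner z x))\<^sup>2 / s\<^sup>2"
        by (simp add: \<kappa>_def norm_scaleC v(1) norm_divide power_divide)
      also have "\<dots> \<le> (norm z * norm x)\<^sup>2 / s\<^sup>2"
        by (intro divide_right_mono power_mono cinner_Cauchy_Schwarz) auto
      also have "\<dots> = (norm z)\<^sup>2 * ((norm x)\<^sup>2 / s\<^sup>2)" by (simp add: power_mult_distrib)
      also have "(norm x)\<^sup>2 / s\<^sup>2 \<le> (1 / 400 / N) / (399 / 400)"
        using s2 x400 xN N by (intro frac_le) auto
      also have "\<dots> \<le> 1 / N" using N by (simp add: field_simps)
      finally show ?thesis by (simp add: mult_left_mono)
    qed
    also have "(norm z)\<^sup>2 + (norm z)\<^sup>2 / N = (N + 1) / N * (norm z)\<^sup>2" using N by (simp add: field_simps)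
    also have "(norm z)\<^sup>2 \<le> (\<Sum>j\<in>{1..n}. real (n + 1) / real (j + 1) * (c j)\<^sup>2)"
      unfolding z_def by (rule growth)
    also have "(N + 1) / N * (\<Sum>j\<in>{1..n}. real (n + 1) / real (j + 1) * (c j)\<^sup>2) =
        (\<Sum>j\<in>{1..n}. real (Suc n + 1) / real (j + 1) * (c j)\<^sup>2)"
      using N by (simp add: sum_distrib_left N_def add.commute)
    also have "(norm (c (Suc n) *\<^sub>R t))\<^sup>2 = real (Suc n + 1) / real (Suc n + 1) * (c (Suc n))\<^sup>2"
      by (simp add: t(1) power_mult_distrib)
    finally show "(norm (\<Sum>j\<in>{1..Suc n}. c j *\<^sub>R p' j))\<^sup>2 \<le>
        (\<Sum>j\<in>{1..Suc n}. real (Suc n + 1) / real (j + 1) * (c j)\<^sup>2)"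
      using N by (simp add: divide_right_mono mult_left_mono)
  next
    \<comment> \<open>\<open>k\<close> is the part of \<open>w\<close> orthogonal to \<open>F\<close>\<close>
    define k where "k = s *\<^sub>R v + y"
    have kF: "k \<in> perp F" unfolding k_def by (intro perp_add perp_scaleR vF y)
    have wk: "w = k + h *\<^sub>R \<rho>" by (simp add: w_def k_def x_def)
    have k: "norm k \<le> 41 / 40"
      using norm_triangle_ineq4[of w "h *\<^sub>R \<rho>"] w1 h\<rho> h40 le40 by (simp add: wk)
    fix j f assume j: "j \<in> {1..Suc n}" and f: "f \<in> perp F"
    have hf: "\<bar>h\<bar> * K * norm f \<le> \<delta> / 400 * norm f" using hK(2) by (intro mult_right_mono) auto
    have kf: "4 * \<delta> * norm k * norm f \<le> 4 * \<delta> * (41 / 40) * norm f"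
      using k \<delta> by (intro mult_left_mono mult_right_mono) auto
    have \<delta>f: "\<delta> * norm f \<ge> 0" using \<delta> by simp
    from split[OF j] show "cmod (cinner (S (u' j)) f) \<le> 8 * \<delta> * norm f"
    proof
      assume "j = Suc n"
      moreover have "cmod (cinner (S w) f) \<le> cmod (cinner (S k) f) + cmod (cinner (S (h *\<^sub>R \<rho>)) f)"
        unfolding wk bounded_clinear_add[OF S] cinner_add_left by (rule norm_triangle_ineq)
      ultimately show ?thesis
        using small[OF kF f] S\<rho>(2)[of f] hf kf \<delta>f unfolding u'_new by (simp add: u'_new)
    qed (use uF f in \<open>simp add: u'_old\<close>)
    from split[OF j] show "cmod (cinner (S f) (u' j)) \<le> 8 * \<delta> * norm f"
    proof
      assume "j = Suc n"
      moreover have "cmod (cinner (S f) w) \<le> cmod (cinner (S f) k) + cmod (cinner (S f) (h *\<^sub>R \<rho>))"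
        unfolding wk cinner_add_right by (rule norm_triangle_ineq)
      moreover have "cmod (cinner (S f) k) \<le> 4 * \<delta> * norm k * norm f"
        using small[OF f kF] by (simp add: mult_ac)
      ultimately show ?thesis
        using S\<rho>(1)[of f] hf kf \<delta>f by (simp add: u'_new)
    qed (use uF f in \<open>simp add: u'_old\<close>)
  qed
  moreover have "\<delta> / 25 \<le> cmod (\<alpha> + cinner (S w) w)"
  proof -
    have "cinner (S w) w = s\<^sup>2 * cinner (S v) v + cinner (S x) x"
      using v(2)[OF inG(1)] v'[OF inG(1)] unfolding Sw by (simp add: w_def cinner_simps power2_eq_square)
    also have "\<dots> = cinner (S v) v + (cinner (S x) x - (norm x)\<^sup>2 * cinner (S v) v)"
      by (simp add: s2 algebra_simps)
    finally have eq: "\<alpha> + cinner (S v) v = (\<alpha> + cinner (S w) w) - (cinner (S x) x - (norm x)\<^sup>2 * cinner (S v) v)"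
      by simp
    have "cmod (\<alpha> + cinner (S v) v) \<le> cmod (\<alpha> + cinner (S w) w) + cmod (cinner (S x) x - (norm x)\<^sup>2 * cinner (S v) v)"
      unfolding eq by (rule norm_triangle_ineq4)
    moreover have "cmod (cinner (S x) x - (norm x)\<^sup>2 * cinner (S v) v) \<le>
        cmod (cinner (S x) x) + (norm x)\<^sup>2 * cmod (cinner (S v) v)"
      using norm_triangle_ineq4[of "cinner (S x) x" "complex_of_real ((norm x)\<^sup>2) * cinner (S v) v"]
      by (simp add: norm_mult norm_power)
    moreover have "(norm x)\<^sup>2 * cmod (cinner (S v) v) \<le> 1 / 400 * (4 * \<delta>)"
      using small[OF vF vF] v(1) x400 \<delta> by (intro mult_mono) auto
    moreover have "cmod (cinner (S x) x) \<le> 4 * \<delta> / 1600 + \<delta> / 400 * (1 / 40) + \<delta> / 400 * (1 / 20)"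
    proof -
      have "cinner (S x) x = cinner (S y) y + cinner (S y) (h *\<^sub>R \<rho>) + cinner (S (h *\<^sub>R \<rho>)) x"
        by (simp add: x_def bounded_clinear_add[OF S] cinner_add_left cinner_add_right)
      also have "cmod \<dots> \<le> cmod (cinner (S y) y) + cmod (cinner (S y) (h *\<^sub>R \<rho>)) + cmod (cinner (S (h *\<^sub>R \<rho>)) x)"
        using norm_triangle_ineq[of "cinner (S y) y + cinner (S y) (h *\<^sub>R \<rho>)" "cinner (S (h *\<^sub>R \<rho>)) x"]
          norm_triangle_ineq[of "cinner (S y) y" "cinner (S y) (h *\<^sub>R \<rho>)"] by simp
      also have "cmod (cinner (S y) y) \<le> 4 * \<delta> / 1600"
      proof -
        have "norm y \<le> 1 / 40" using y(3) le40 by simp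
        then have "4 * \<delta> * norm y * norm y \<le> 4 * \<delta> * (1 / 40) * (1 / 40)" using \<delta> by (intro mult_mono) auto
        then show ?thesis using small[OF y(1) y(1)] by simp
      qed
      also have "cmod (cinner (S y) (h *\<^sub>R \<rho>)) \<le> \<delta> / 400 * (1 / 40)"
      proof -
        have "norm y \<le> 1 / 40" using y(3) le40 by simp
        then have "\<bar>h\<bar> * K * norm y \<le> \<delta> / 400 * (1 / 40)" using hK(2) \<delta> by (intro mult_mono) auto
        then show ?thesis using S\<rho>(1)[of y] by simp
      qed
      also have "cmod (cinner (S (h *\<^sub>R \<rho>)) x) \<le> \<delta> / 400 * (1 / 20)"
      proof -
        have "norm x \<le> 1 / 20" using x_le le40 by simp
        then have "\<bar>h\<bar> * K * norm x \<le> \<delta> / 400 * (1 / 20)" using hK(2) \<delta> by (intro mult_mono) auto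
        then show ?thesis using S\<rho>(2)[of x] by simp
      qed
      finally show ?thesis by simp
    qed
    ultimately show ?thesis using diag \<delta> by simp
  qed
  moreover have "cinner (S w) (u j) = cinner (S x) (u j)" "cinner (S (u j)) w = cinner (S (u j)) x" if j: "j \<in> {1..n}" for j
    using v(2)[OF inG(2)[OF j]] v'[OF inG(2)[OF j]] unfolding Sw by (simp_all add: w_def cinner_simps)
  moreover have "cinner r w = cinner r x" using v'[OF rG] by (simp add: w_def cinner_simps)
  ultimately show ?thesis
    using low up drain unfolding u'_def x_def[symmetric]
    by (intro exI[of _ w] exI[of _ p']) (auto simp: balanced_entry_def N_def)
qed

end

section \<open>Completeness of the system\<close>

text \<open>
  The positive integers whose multiplicity of \<open>2\<close> is \<open>k\<close>, for \<open>k = 0, 1, \<dots>\<close>, divide the steps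
  of the construction among the members of a dense sequence. Each class is large enough for the
  harmonic series over it to diverge.
\<close>

lemma not_summable_fixed_multiplicity:
  "\<not> summable (\<lambda>l. 1 / real (2 ^ k * (2 * l + 1)))"
proof
  assume "summable (\<lambda>l. 1 / real (2 ^ k * (2 * l + 1)))"
  then have "summable (\<lambda>l. 2 * 2 ^ k * (1 / real (2 ^ k * (2 * l + 1))))" by (rule summable_mult)
  moreover have "2 * 2 ^ k * (1 / real (2 ^ k * (2 * l + 1))) = 2 / real (2 * l + 1)" for l
  proof -
    have "2 * a * (1 / (a * X)) = 2 / X" if "a > 0" for a X :: real using that by simp
    then show ?thesis unfolding of_nat_mult[of "2 ^ k"] by simp
  qed
  ultimately have s: "summable (\<lambda>l. 2 / real (2 * l + 1))" by simp
  have "summable (\<lambda>l. inverse (real (Suc l)))"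
  proof (rule summable_comparison_test'[OF s])
    fix l show "norm (inverse (real (Suc l))) \<le> 2 / real (2 * l + 1)" by (simp add: field_simps)
  qed
  then show False using not_summable_harmonic[where 'a = real] summable_Suc_iff[of "\<lambda>n. inverse (real n)"]
    by simp
qed

lemma multiplicity_2: "multiplicity 2 (2 ^ k * (2 * l + 1) :: nat) = k"
proof (rule multiplicity_eqI)
  show "2 ^ k dvd 2 ^ k * (2 * l + 1)" by (rule dvd_triv_left)
  show "\<not> 2 ^ Suc k dvd 2 ^ k * (2 * l + 1)"
    unfolding power_Suc2 nat_mult_dvd_cancel_disj by simp
qed

lemma residual_step:
  fixes u :: "nat \<Rightarrow> 'a::complex_inner" and g :: 'a
  assumes on: "\<And>i j. i \<in> {1..Suc n} \<Longrightarrow> j \<in> {1..Suc n} \<Longrightarrow> cinner (u i) (u j) = (if i = j then 1 else 0)"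
  defines "R \<equiv> \<lambda>n. g - proj (u ` {1..n}) g"
  shows "(norm (R (Suc n)))\<^sup>2 = (norm (R n))\<^sup>2 - (cmod (cinner (R n) (u (Suc n))))\<^sup>2"
proof -
  have ons: "orthonormal_set (u ` {1..m})" if "m \<le> Suc n" for m
    using on that unfolding orthonormal_set_def by fastforce
  have new: "u (Suc n) \<notin> u ` {1..n}"
  proof
    assume "u (Suc n) \<in> u ` {1..n}"
    then obtain i where "i \<in> {1..n}" "u (Suc n) = u i" by auto
    then show False using on[of i i] on[of i "Suc n"] by auto
  qed
  have set: "u ` {1..Suc n} = insert (u (Suc n)) (u ` {1..n})" by (auto simp: atLeastAtMostSuc_conv)
  have "proj (u ` {1..Suc n}) g = cinner g (u (Suc n)) *\<^sub>C u (Suc n) + proj (u ` {1..n}) g"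
    unfolding set proj_def using new by simp
  moreover have orth: "cinner (u (Suc n)) (proj (u ` {1..n}) g) = 0"
    using on by (intro cinner_perp_proj) (auto simp: perp_def)
  then have gr: "cinner g (u (Suc n)) = cinner (R n) (u (Suc n))"
    using cinner_eq_zero_commute by (auto simp: R_def cinner_simps)
  ultimately have "R n = R (Suc n) + cinner (R n) (u (Suc n)) *\<^sub>C u (Suc n)"
    by (simp add: R_def)
  moreover have "R (Suc n) \<in> perp (u ` {1..Suc n})" unfolding R_def by (rule diff_proj_perp[OF ons]) simp
  then have "cinner (R (Suc n)) (cinner (R n) (u (Suc n)) *\<^sub>C u (Suc n)) = 0"
    by (auto simp: perp_def cinner_simps)
  ultimately have "(norm (R n))\<^sup>2 = (norm (R (Suc n)))\<^sup>2 + (norm (cinner (R n) (u (Suc n)) *\<^sub>C u (Suc n)))\<^sup>2"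
    using pythagoras by metis
  moreover have "norm (u (Suc n)) = 1" using on[of "Suc n" "Suc n"] by (simp add: norm_eq_1_cinner)
  ultimately show ?thesis by (simp add: norm_scaleC)
qed

text \<open>
  If the residuals of \<open>g\<close> stayed above \<open>e\<close>, each step \<open>n\<close> with multiplicity \<open>k\<close> would remove at least
  \<open>\<epsilon>\<^sup>2 * e\<^sup>2 / n\<close> from the squared norm of the residual, and these amounts have infinite sum.
\<close>

lemma drained_in_closure:
  fixes u :: "nat \<Rightarrow> 'a::complex_inner"
  assumes u: "orthonormal_seq u" and \<epsilon>: "\<epsilon> > 0"
    and drain: "\<And>n. multiplicity 2 (Suc n) = k \<Longrightarrow>
      \<epsilon> / sqrt (real (Suc n)) * norm (g - proj (u ` {1..n}) g) \<le> cmod (cinner (g - proj (u ` {1..n}) g) (u (Suc n)))"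
  shows "g \<in> closure (cspan (u ` {1..}))"
proof -
  define d where "d n = (norm (g - proj (u ` {1..n}) g))\<^sup>2" for n
  have step: "d (Suc n) = d n - (cmod (cinner (g - proj (u ` {1..n}) g) (u (Suc n))))\<^sup>2" for n
    unfolding d_def using u by (intro residual_step) (auto simp: orthonormal_seq_def)
  have dec: "d n \<le> d m" if "m \<le> n" for m n
    by (rule lift_Suc_antimono_le[OF _ that]) (simp add: step)
  have "\<exists>n. d n < e\<^sup>2" if e: "e > 0" for e
  proof (rule ccontr)
    assume "\<not> (\<exists>n. d n < e\<^sup>2)"
    then have big: "e\<^sup>2 \<le> d n" for n by (simp add: not_less)
    define N where "N l = 2 ^ k * (2 * l + 1)" for l :: nat
    have N: "strict_mono N" by (rule strict_monoI) (simp add: N_def)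
    have drop: "d (N l) \<le> d (N l - 1) - \<epsilon>\<^sup>2 * e\<^sup>2 * (1 / real (N l))" for l
    proof -
      have Nl: "Suc (N l - 1) = N l" by (simp add: N_def)
      have "\<epsilon>\<^sup>2 * (1 / real (N l)) * e\<^sup>2 \<le> \<epsilon>\<^sup>2 * (1 / real (N l)) * d (N l - 1)"
        using big by (intro mult_left_mono) auto
      also have "\<dots> = (\<epsilon> / sqrt (real (N l)) * norm (g - proj (u ` {1..N l - 1}) g))\<^sup>2"
        by (simp add: d_def power_mult_distrib power_divide)
      also have "\<dots> \<le> (cmod (cinner (g - proj (u ` {1..N l - 1}) g) (u (N l))))\<^sup>2"
        using drain[of "N l - 1"] \<epsilon> unfolding Nl
        by (intro power_mono) (auto simp: N_def multiplicity_2[simplified])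
      finally show ?thesis using step[of "N l - 1"] unfolding Nl by (simp add: mult_ac)
    qed
    have partial: "\<epsilon>\<^sup>2 * e\<^sup>2 * (\<Sum>l<m. 1 / real (N l)) \<le> d 0 - d (N m - 1)" for m
    proof (induction m)
      case 0
      show ?case using dec[of 0 "N 0 - 1"] by simp
    next
      case (Suc m)
      have "N m < N (Suc m)" using N by (simp add: strict_mono_less)
      then have "d (N (Suc m) - 1) \<le> d (N m)" by (intro dec) simp
      then show ?case using Suc drop[of m] by (simp add: algebra_simps)
    qed
    have "summable (\<lambda>l. 1 / real (N l))"
    proof (rule summableI_nonneg_bounded)
      fix m
      have "\<epsilon>\<^sup>2 * e\<^sup>2 * (\<Sum>l<m. 1 / real (N l)) \<le> d 0"
      proof -
        have "0 \<le> d (N m - 1)" by (simp add: d_def)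
        then show ?thesis using partial[of m] by argo
      qed
      then show "(\<Sum>l<m. 1 / real (N l)) \<le> d 0 / (\<epsilon>\<^sup>2 * e\<^sup>2)"
        using \<epsilon> e by (simp add: field_simps)
    qed simp
    then show False using not_summable_fixed_multiplicity[of k] by (simp add: N_def)
  qed
  note d_small = this
  have "\<exists>y\<in>cspan (u ` {1..}). dist y g < e" if e: "e > 0" for e
  proof -
    obtain n where "d n < e\<^sup>2" using d_small[OF e] by blast
    then have "norm (g - proj (u ` {1..n}) g) < e" using e unfolding d_def by (simp add: power2_less_imp_less)
    moreover have "proj (u ` {1..n}) g \<in> cspan (u ` {1..})"
      unfolding proj_def by (intro complex_vector.span_sum complex_vector.span_scale complex_vector.span_base) auto
    ultimately show ?thesis by (auto simp: dist_norm norm_minus_commute)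
  qed
  then show ?thesis by (simp add: closure_approachable)
qed

lemma separable_dense_sequence:
  assumes "separable_space (euclidean :: 'a::metric_space topology)"
  obtains g :: "nat \<Rightarrow> 'a::metric_space" where "closure (range g) = UNIV"
proof -
  obtain C :: "'a set" where C: "countable C" "closure C = UNIV"
    using assms by (auto simp: separable_space_def)
  then have "C \<noteq> {}" by auto
  then have "range (from_nat_into C) = C" using C(1) by (rule range_from_nat_into)
  then show ?thesis using C(2) by (intro that[of "from_nat_into C"]) simp
qed

context essentially_small
begin

lemma admissible_0: "admissible 0 u p"
  by (simp add: admissible_def)

lemma spread_basis_for_shift:
  fixes g :: "nat \<Rightarrow> 'a"
  assumes g: "closure (range g) = (UNIV :: 'a set)"
  obtains u where "orthonormal_basis u"
    "\<And>n. n \<ge> 1 \<Longrightarrow> \<delta> / 25 \<le> cmod (\<alpha> + cinner (S (u n)) (u n))"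
    "\<And>n j. 1 \<le> j \<Longrightarrow> j < n \<Longrightarrow>
      balanced_entry \<delta> j n (cinner (S (u n)) (u j)) \<and> balanced_entry \<delta> j n (cinner (S (u j)) (u n))"
proof -
  define good where "good n u w \<longleftrightarrow> \<delta> / 25 \<le> cmod (\<alpha> + cinner (S w) w) \<and>
    (\<forall>j\<in>{1..n}. balanced_entry \<delta> j (Suc n) (cinner (S w) (u j)) \<and>
      balanced_entry \<delta> j (Suc n) (cinner (S (u j)) w)) \<and>
    \<epsilon> / sqrt (real (Suc n)) * norm (g (multiplicity 2 (Suc n)) - proj (u ` {1..n}) (g (multiplicity 2 (Suc n))))
      \<le> cmod (cinner (g (multiplicity 2 (Suc n)) - proj (u ` {1..n}) (g (multiplicity 2 (Suc n)))) w)"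
    for n and u :: "nat \<Rightarrow> 'a" and w
  have "\<exists>f. \<forall>n. admissible n (fst (f n)) (snd (f n)) \<and>
      (\<exists>w. fst (f (Suc n)) = (fst (f n))(Suc n := w) \<and> good n (fst (f n)) w)"
  proof (rule dependent_nat_choice)
    show "\<exists>x. admissible 0 (fst x) (snd x)" by (simp add: admissible_0)
    fix x n assume "admissible n (fst x) (snd x)"
    from extend_admissible[OF this, of "g (multiplicity 2 (Suc n))"]
    obtain w p' where "admissible (Suc n) ((fst x)(Suc n := w)) p'" "good n (fst x) w"
      unfolding good_def by blast
    then show "\<exists>y. admissible (Suc n) (fst y) (snd y) \<and> (\<exists>w. fst y = (fst x)(Suc n := w) \<and> good n (fst x) w)"
      by (intro exI[of _ "((fst x)(Suc n := w), p')"]) auto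
  qed
  then obtain f where f: "\<And>n. admissible n (fst (f n)) (snd (f n))"
    "\<And>n. \<exists>w. fst (f (Suc n)) = (fst (f n))(Suc n := w) \<and> good n (fst (f n)) w"
    by blast
  define u where "u n = fst (f n) n" for n
  have stable: "fst (f m) j = u j" if "j \<le> m" for j m
    using that
  proof (induction m)
    case (Suc m)
    then show ?case using f(2)[of m] by (cases "j = Suc m") (auto simp: u_def)
  qed (simp add: u_def)
  have good: "good n u (u (Suc n))" for n
  proof -
    have "good n (fst (f n)) (u (Suc n))" using f(2)[of n] by (auto simp: u_def)
    moreover have "fst (f n) ` {1..n} = u ` {1..n}" using stable by auto
    ultimately show ?thesis using stable unfolding good_def by auto
  qed
  have on: "orthonormal_seq u"
    unfolding orthonormal_seq_def
  proof (intro allI impI)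
    fix m n :: nat assume "1 \<le> m" "1 \<le> n"
    then have "m \<in> {1..max m n}" "n \<in> {1..max m n}" by auto
    then have "cinner (fst (f (max m n)) m) (fst (f (max m n)) n) = (if m = n then 1 else 0)"
      using f(1)[of "max m n"] unfolding admissible_def by blast
    then show "cinner (u m) (u n) = (if m = n then 1 else 0)" using stable by simp
  qed
  have "g k \<in> closure (cspan (u ` {1..}))" for k
    using on \<epsilon>(1) good by (intro drained_in_closure[where \<epsilon> = \<epsilon> and k = k]) (auto simp: good_def)
  then have "closure (range g) \<subseteq> closure (cspan (u ` {1..}))" by (intro closure_minimal) auto
  then have basis: "orthonormal_basis u" using on g by (auto simp: orthonormal_basis_def)
  show ?thesis
  proof (rule that[OF basis])
    fix n :: nat assume "n \<ge> 1"
    then show "\<delta> / 25 \<le> cmod (\<alpha> + cinner (S (u n)) (u n))"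
      using good[of "n - 1"] by (simp add: good_def)
  next
    fix n j :: nat assume "1 \<le> j" "j < n"
    then show "balanced_entry \<delta> j n (cinner (S (u n)) (u j)) \<and> balanced_entry \<delta> j n (cinner (S (u j)) (u n))"
      using good[of "n - 1"] by (auto simp: good_def)
  qed
qed

end

section \<open>Bases for operators that are not scalar plus compact\<close>

lemma powr_three_halves: "x \<ge> 0 \<Longrightarrow> x powr (3/2) = x * sqrt x"
  using powr_add[of x 1 "1/2"] by (simp add: powr_half_sqrt)

lemma spread_basis_exists:
  fixes T :: "'a::complex_hilbert \<Rightarrow> 'a"
  assumes sep: "separable_space (euclidean :: 'a topology)"
    and T: "bounded_clinear T" and nc: "\<not> (\<exists>z K. compact_operator K \<and> T = (\<lambda>x. z *\<^sub>C x + K x))"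
  defines "\<delta> \<equiv> diameter (ess_num_range T)"
  obtains u where "orthonormal_basis u"
    "\<And>n. n \<ge> 1 \<Longrightarrow> \<delta> / 25 \<le> cmod (cinner (T (u n)) (u n))"
    "\<And>n j. 1 \<le> j \<Longrightarrow> j < n \<Longrightarrow>
      balanced_entry \<delta> j n (cinner (T (u n)) (u j)) \<and> balanced_entry \<delta> j n (cinner (T (u j)) (u n))"
proof -
  have \<delta>: "\<delta> > 0" unfolding \<delta>_def by (rule diameter_ess_num_range_pos[OF T nc])
  obtain \<alpha> \<mu> where \<alpha>\<mu>: "\<alpha> \<in> ess_num_range T" "\<mu> \<in> ess_num_range T" "\<delta> / 2 \<le> cmod (\<alpha> - \<mu>)"
    "7 * \<delta> / 100 \<le> cmod ((16 * \<alpha> + 9 * \<mu>) / 25)"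
    by (rule ess_num_range_spread_pair[OF T meta_eq_to_obj_eq[OF \<delta>_def] \<delta>])
  define S where "S = (\<lambda>x. T x - \<alpha> *\<^sub>C x)"
  have S: "bounded_clinear S" unfolding S_def by (rule bounded_clinear_shift[OF T])
  obtain K where K: "K > 0" "\<And>x. norm (S x) \<le> K * norm x" using bounded_clinear_bound[OF S] by blast
  define \<epsilon> where "\<epsilon> = min (1 / 40) (\<delta> / (400 * K))"
  obtain F where F: "finite F" "\<And>x y. x \<in> perp F \<Longrightarrow> y \<in> perp F \<Longrightarrow>
      cmod (cinner (T x - \<alpha> *\<^sub>C x) y) \<le> 4 * \<delta> * norm x * norm y"
    by (rule essentially_small_shift[OF T meta_eq_to_obj_eq[OF \<delta>_def] \<delta> \<alpha>\<mu>(1)]) blast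
  interpret essentially_small S \<alpha> \<delta> K \<epsilon> F
  proof
    show "bounded_clinear S" "\<delta> > 0" "K > 0" "norm (S x) \<le> K * norm x" "finite F" for x by (fact S \<delta> K F)+
    show "\<epsilon> > 0" "\<epsilon> \<le> 1 / 40" using \<delta> K(1) by (auto simp: \<epsilon>_def)
    have "K * \<epsilon> \<le> K * (\<delta> / (400 * K))" using K(1) by (intro mult_left_mono) (auto simp: \<epsilon>_def)
    then show "K * \<epsilon> \<le> \<delta> / 400" using K(1) by simp
    show "cmod (cinner (S x) y) \<le> 4 * \<delta> * norm x * norm y" if "x \<in> perp F" "y \<in> perp F" for x y
      using F(2)[OF that] by (simp add: S_def)
    show "\<exists>v t. norm v = 1 \<and> norm t = 1 \<and> cinner v t = 0 \<and>
      (\<forall>y\<in>G. cinner v y = 0 \<and> cinner v (S y) = 0 \<and> cinner (S v) y = 0) \<and>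
      (\<forall>y\<in>G. cinner t y = 0 \<and> cinner t (S y) = 0 \<and> cinner (S t) y = 0) \<and>
      cinner (S t) v = cinner (S v) t \<and> 23 * \<delta> / 100 \<le> cmod (cinner (S v) t) \<and>
      6 * \<delta> / 100 \<le> cmod (\<alpha> + cinner (S v) v)" if "finite G" for G
      unfolding S_def by (rule fresh_pair[OF T \<alpha>\<mu>(1,2) \<delta> \<alpha>\<mu>(3,4) that]) blast
  qed
  obtain g :: "nat \<Rightarrow> 'a" where "closure (range g) = UNIV" by (rule separable_dense_sequence[OF sep])
  from spread_basis_for_shift[OF this] obtain u where u: "orthonormal_basis u"
    "\<And>n. n \<ge> 1 \<Longrightarrow> \<delta> / 25 \<le> cmod (\<alpha> + cinner (S (u n)) (u n))"
    "\<And>n j. 1 \<le> j \<Longrightarrow> j < n \<Longrightarrow>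
      balanced_entry \<delta> j n (cinner (S (u n)) (u j)) \<and> balanced_entry \<delta> j n (cinner (S (u j)) (u n))"
    by blast
  have uu: "cinner (u m) (u n) = (if m = n then 1 else 0)" if "m \<ge> 1" "n \<ge> 1" for m n
    using u(1) that by (simp add: orthonormal_basis_def orthonormal_seq_def)
  show ?thesis
  proof (rule that[OF u(1)])
    show "\<delta> / 25 \<le> cmod (cinner (T (u n)) (u n))" if "n \<ge> 1" for n
      using u(2)[OF that] uu[OF that that] by (simp add: S_def cinner_simps)
    show "balanced_entry \<delta> j n (cinner (T (u n)) (u j)) \<and> balanced_entry \<delta> j n (cinner (T (u j)) (u n))"
      if "1 \<le> j" "j < n" for n j
      using u(3)[OF that] uu[of n j] uu[of j n] that by (simp add: S_def cinner_simps)
  qed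
qed

theorem theorem2p8:
  assumes "separable_space (euclidean :: 'a::complex_hilbert topology)"
    and "infinite_dimensional TYPE('a)"
  shows "\<exists>c1 c2 d :: real \<Rightarrow> real.
    (\<forall>\<delta>. 0 < c1 \<delta> \<and> 0 < c2 \<delta> \<and> 0 < d \<delta>) \<and>
    (\<forall>T :: 'a \<Rightarrow> 'a.
      bounded_clinear T \<and>
      \<not> (\<exists>z K. compact_operator K \<and> T = (\<lambda>x. z *\<^sub>C x + K x)) \<longrightarrow>
      (\<exists>u. orthonormal_basis u \<and>
        (\<forall>n\<ge>1. cmod (cinner (T (u n)) (u n)) \<ge> d (diameter (ess_num_range T))) \<and>
        (\<forall>n\<ge>1. \<forall>j\<ge>1. n \<noteq> j \<longrightarrow>
          c1 (diameter (ess_num_range T)) * real (min n j) powr (1/2) / real (max n j) powr (3/2)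
            \<le> cmod (cinner (T (u n)) (u j)) \<and>
          cmod (cinner (T (u n)) (u j))
            \<le> c2 (diameter (ess_num_range T)) / real (max n j) powr (1/2))))"
proof -
  \<comment> \<open>the constants must be positive for every real argument, though only positive diameters occur\<close>
  define pos where "pos \<delta> = (if \<delta> > 0 then \<delta> else 1)" for \<delta> :: real
  have pos: "pos \<delta> > 0" for \<delta> by (simp add: pos_def)
  show ?thesis
  proof (rule exI[of _ "\<lambda>\<delta>. pos \<delta> / 1600"], rule exI[of _ pos], rule exI[of _ "\<lambda>\<delta>. pos \<delta> / 25"],
      intro conjI allI impI)
    show "0 < pos \<delta> / 1600" "0 < pos \<delta>" "0 < pos \<delta> / 25" for \<delta> using pos[of \<delta>] by simp_all
    fix T :: "'a \<Rightarrow> 'a"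
    assume T: "bounded_clinear T \<and> \<not> (\<exists>z K. compact_operator K \<and> T = (\<lambda>x. z *\<^sub>C x + K x))"
    define \<delta> where "\<delta> = diameter (ess_num_range T)"
    have "\<delta> > 0" unfolding \<delta>_def using T by (intro diameter_ess_num_range_pos) auto
    then have pos\<delta>: "pos \<delta> = \<delta>" by (simp add: pos_def)
    obtain u where u: "orthonormal_basis u"
      "\<And>n. n \<ge> 1 \<Longrightarrow> \<delta> / 25 \<le> cmod (cinner (T (u n)) (u n))"
      "\<And>n j. 1 \<le> j \<Longrightarrow> j < n \<Longrightarrow>
        balanced_entry \<delta> j n (cinner (T (u n)) (u j)) \<and> balanced_entry \<delta> j n (cinner (T (u j)) (u n))"
      using spread_basis_exists[OF assms(1) conjunct1[OF T] conjunct2[OF T]] unfolding \<delta>_def by blast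
    have "\<delta> / 1600 * real (min n j) powr (1/2) / real (max n j) powr (3/2) \<le> cmod (cinner (T (u n)) (u j)) \<and>
        cmod (cinner (T (u n)) (u j)) \<le> \<delta> / real (max n j) powr (1/2)"
      if "n \<ge> 1" "j \<ge> 1" "n \<noteq> j" for n j
      using u(3)[of j n] u(3)[of n j] that
      by (cases "j < n") (simp_all add: balanced_entry_def powr_half_sqrt powr_three_halves)
    then show "\<exists>u. orthonormal_basis u \<and>
        (\<forall>n\<ge>1. pos (diameter (ess_num_range T)) / 25 \<le> cmod (cinner (T (u n)) (u n))) \<and>
        (\<forall>n\<ge>1. \<forall>j\<ge>1. n \<noteq> j \<longrightarrow>
          pos (diameter (ess_num_range T)) / 1600 * real (min n j) powr (1/2) / real (max n j) powr (3/2)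
            \<le> cmod (cinner (T (u n)) (u j)) \<and>
          cmod (cinner (T (u n)) (u j)) \<le> pos (diameter (ess_num_range T)) / real (max n j) powr (1/2))"
      unfolding \<delta>_def[symmetric] pos\<delta> using u(1,2) by (intro exI[of _ u]) blast
  qed
qed

end
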